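(* Let $T>0$ and let $(z_n)_{n\in\mathbb N}$ be the sequence defined in the context. There is a subsequence $z_{n_k}$ that is weakly convergent in $L^2((0,T)\times\Omega)$. Moreover, $$\chi_{A_{n_k}}(x)z_{n_k}(t,x)\rightharpoonup a(t,x),\qquad \chi_{B_{n_k}}(x)z_{n_k}(t,x)\rightharpoonup b(t,x)\qquad\text{weakly in }L^2((0,T)\times\Omega),$$ where $(a,b)$ is a solution either to the system $$\begin{aligned} \frac{\partial a}{\partial t}(t,x)&=\int_\Omega J(x,y)\big(X(x)a(t,y)-X(y)a(t,x)\big)dy+\int_\Omega R(x,y)\big(X(x)b(t,y)-(1-X(y))a(t,x)\big)dy+e^{-t}J(\bar x,x)X(x),\\ \frac{\partial b}{\partial t}(t,x)&=\int_\Omega G(x,y)\big((1-X(x))b(t,y)-(1-X(y))b(t,x)\big)dy+\int_\Omega R(x,y)\big((1-X(x))a(t,y)-X(y)b(t,x)\big)dy+e^{-t}R(\bar x,x)(1-X(x)), \end{aligned}$$ for $t>0$, $x\in\Omega$, with $a(0,x)=b(0,x)=0$, or to the system $$\begin{aligned} \frac{\partial a}{\partial t}(t,x)&=\int_\Omega J(x,y)\big(X(x)a(t,y)-X(y)a(t,x)\big)dy+\int_\Omega R(x,y)\big(X(x)b(t,y)-(1-X(y))a(t,x)\big)dy+e^{-t}R(\bar x,x)X(x),\\ \frac{\partial b}{\partial t}(t,x)&=\int_\Omega G(x,y)\big((1-X(x))b(t,y)-(1-X(y))b(t,x)\big)dy+\int_\Omega R(x,y)\big((1-X(x))a(t,y)-X(y)b(t,x)\big)dy+e^{-t}G(\bar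 x,x)(1-X(x)), \end{aligned}$$ for $t>0$, $x\in\Omega$, with $a(0,x)=b(0,x)=0$.
   Context: $\Omega\subset\mathbb R^N$ is a bounded domain. Each kernel $V\in\{J,G,R\}$ is a function $V:\mathbb R^N\times\mathbb R^N\to\mathbb R$ that is continuous, non-negative, symmetric ($V(x,y)=V(y,x)$), satisfies $V(x,x)>0$ for every $x$, and $\int_{\mathbb R^N}V(x,y)\,dy=1$ for every $x$. For each $n$, $\overline\Omega=A_n\cup B_n$ with $A_n\cap B_n=\emptyset$, $B_n$ open with Lipschitz boundary (so $|\partial A_n\cap\Omega|=|\partial B_n\cap\Omega|=0$). It is assumed that $\chi_{A_n}\rightharpoonup X$ and $\chi_{B_n}\rightharpoonup 1-X$ weakly in $L^\infty(\overline\Omega)$ (i.e. tested against $L^1$ functions), with $0<X(x)<1$. Fix $\bar x\in\Omega$. It is assumed that, for every $n$, $$\chi_{A_n}(\bar x)\int_\Omega\chi_{A_n}(y)J(\bar x,y)dy+\chi_{B_n}(\bar x)\int_\Omega\chi_{B_n}(y)G(\bar x,y)dy+\chi_{A_n}(\bar x)\int_\Omega\chi_{B_n}(y)R(\bar x,y)dy+\chi_{B_n}(\bar x)\int_\Omega\chi_{A_n}(y)R(\bar x,y)dy=1.$$ $z_n(t,x)$ is the solution, with $z_n(t,\cdot)\in L^2(\Omega)$ and $z_n(0,x)=0$, of $$\begin{aligned} \frac{\partial z_n}{\partial t}(t,x)=&\chi_{A_n}(x)\int_\Omega\chi_{A_n}(y)J(x,y)(z_n(t,y)-z_n(t,x))dy+e^{-t}\chi_{A_n}(\bar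 x)\chi_{A_n}(x)J(\bar x,x)\\ &+\chi_{B_n}(x)\int_\Omega\chi_{B_n}(y)G(x,y)(z_n(t,y)-z_n(t,x))dy+e^{-t}\chi_{B_n}(\bar x)\chi_{B_n}(x)G(\bar x,x)\\ &+\chi_{A_n}(x)\int_\Omega\chi_{B_n}(y)R(x,y)(z_n(t,y)-z_n(t,x))dy+e^{-t}\chi_{A_n}(\bar x)\chi_{B_n}(x)R(\bar x,x)\\ &+\chi_{B_n}(x)\int_\Omega\chi_{A_n}(y)R(x,y)(z_n(t,y)-z_n(t,x))dy+e^{-t}\chi_{B_n}(\bar x)\chi_{A_n}(x)R(\bar x,x). \end{aligned}$$ (It is the absolutely continuous part of the law at time $t$, namely $z_n(t,x)dx+e^{-t}\delta_{\bar x}(dx)$, of the corresponding jump process started at $\bar x$.) *)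

theory Defs
  imports "HOL-Analysis.Analysis"
begin

section \<open>Kernels and Lipschitz boundaries\<close>

definition jump_kernel :: "('a::euclidean_space \<Rightarrow> 'a \<Rightarrow> real) \<Rightarrow> bool" where
  "jump_kernel V \<longleftrightarrow>
     continuous_on UNIV (\<lambda>(x, y). V x y) \<and>
     (\<forall>x y. 0 \<le> V x y) \<and>
     (\<forall>x y. V x y = V y x) \<and>
     (\<forall>x. 0 < V x x) \<and>
     (\<forall>x. has_bochner_integral lborel (V x) 1)"

text \<open>
  Near each boundary point the open set \<open>B\<close> is the strict epigraph of a Lipschitz function, in
  the direction of some unit vector \<open>e\<close>; the graph function \<open>\<gamma>\<close> lives on the hyperplane
  orthogonal to \<open>e\<close>.
\<close>

definition lipschitz_boundary :: "'a::euclidean_space set \<Rightarrow> bool" where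
  "lipschitz_boundary B \<longleftrightarrow>
     (\<forall>p\<in>frontier B. \<exists>r>0. \<exists>e \<gamma> L. norm e = 1 \<and> L-lipschitz_on {y. y \<bullet> e = 0} \<gamma> \<and>
        B \<inter> ball p r = {x \<in> ball p r. \<gamma> (x - (x \<bullet> e) *\<^sub>R e) < x \<bullet> e})"

section \<open>Lebesgue spaces and convergence\<close>

text \<open>
  Elements of Lebesgue spaces are represented by Borel functions; every class of Lebesgue
  measurable functions modulo null sets has such a representative.
\<close>

definition L2 :: "'b::euclidean_space set \<Rightarrow> ('b \<Rightarrow> real) set" where
  "L2 S = {f. set_borel_measurable lborel S f \<and> set_integrable lborel S (\<lambda>x. (f x)\<^sup>2)}"

definition L2_norm :: "'b::euclidean_space set \<Rightarrow> ('b \<Rightarrow> real) \<Rightarrow> real" where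
  "L2_norm S f = sqrt (LINT x:S|lborel. (f x)\<^sup>2)"

definition L2_tendsto ::
  "'b::euclidean_space set \<Rightarrow> ('i \<Rightarrow> 'b \<Rightarrow> real) \<Rightarrow> ('b \<Rightarrow> real) \<Rightarrow> 'i filter \<Rightarrow> bool" where
  "L2_tendsto S f g F \<longleftrightarrow>
     (\<forall>\<^sub>F i in F. f i \<in> L2 S) \<and> g \<in> L2 S \<and> ((\<lambda>i. L2_norm S (\<lambda>x. f i x - g x)) \<longlongrightarrow> 0) F"

definition weakly_L2 ::
  "'b::euclidean_space set \<Rightarrow> (nat \<Rightarrow> 'b \<Rightarrow> real) \<Rightarrow> ('b \<Rightarrow> real) \<Rightarrow> bool" where
  "weakly_L2 S f g \<longleftrightarrow>
     (\<forall>k. f k \<in> L2 S) \<and> g \<in> L2 S \<and>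
     (\<forall>\<phi>\<in>L2 S. (\<lambda>k. LINT x:S|lborel. f k x * \<phi> x) \<longlonglongrightarrow> (LINT x:S|lborel. g x * \<phi> x))"

definition Linf :: "'b::euclidean_space set \<Rightarrow> ('b \<Rightarrow> real) set" where
  "Linf S = {f. set_borel_measurable lborel S f \<and> (\<exists>C. AE x in lborel. x \<in> S \<longrightarrow> \<bar>f x\<bar> \<le> C)}"

text \<open>Weak convergence in \<open>L\<^sup>\<infinity>(S)\<close>, tested against \<open>L\<^sup>1(S)\<close>.\<close>

definition weakly_Linf ::
  "'b::euclidean_space set \<Rightarrow> (nat \<Rightarrow> 'b \<Rightarrow> real) \<Rightarrow> ('b \<Rightarrow> real) \<Rightarrow> bool" where
  "weakly_Linf S f g \<longleftrightarrow>
     (\<forall>n. f n \<in> Linf S) \<and> g \<in> Linf S \<and>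
     (\<forall>\<phi>. set_integrable lborel S \<phi> \<longrightarrow>
        (\<lambda>n. LINT x:S|lborel. f n x * \<phi> x) \<longlonglongrightarrow> (LINT x:S|lborel. g x * \<phi> x))"

section \<open>Evolution equations\<close>

text \<open>
  \<open>solves_from_zero S u F\<close>: the function \<open>u\<close> belongs to
  \<open>C([0,\<infinity>); L\<^sup>2(S))\<close>, vanishes at time \<open>0\<close>, and satisfies
  \<open>\<partial>u/\<partial>t = F\<close> for \<open>t > 0\<close>, the time derivative being the limit of difference quotients in
  \<open>L\<^sup>2(S)\<close>. (Continuity at \<open>t > 0\<close> follows from differentiability.) Joint
  measurability is a requirement on the choice of representatives of \<open>u t\<close>, and makes \<open>u\<close> a
  function on space-time.
\<close>

definition solves_from_zero ::
  "'a::euclidean_space set \<Rightarrow> (real \<Rightarrow> 'a \<Rightarrow> real) \<Rightarrow> (real \<Rightarrow> 'a \<Rightarrow> real) \<Rightarrow> bool" where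
  "solves_from_zero S u F \<longleftrightarrow>
     set_borel_measurable lborel ({0<..} \<times> S) (\<lambda>(t, x). u t x) \<and>
     (\<forall>t\<ge>0. u t \<in> L2 S) \<and>
     (\<forall>x\<in>S. u 0 x = 0) \<and>
     L2_tendsto S u (u 0) (at_right 0) \<and>
     (\<forall>t>0. L2_tendsto S (\<lambda>s x. (u s x - u t x) / (s - t)) (F t) (at t))"

definition jump_rhs ::
  "'a::euclidean_space set \<Rightarrow> ('a \<Rightarrow> 'a \<Rightarrow> real) \<Rightarrow> ('a \<Rightarrow> 'a \<Rightarrow> real) \<Rightarrow> ('a \<Rightarrow> 'a \<Rightarrow> real) \<Rightarrow>
   'a set \<Rightarrow> 'a set \<Rightarrow> 'a \<Rightarrow> (real \<Rightarrow> 'a \<Rightarrow> real) \<Rightarrow> real \<Rightarrow> 'a \<Rightarrow> real" where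
  "jump_rhs \<Omega> J G R A B xb z t x =
     indicator A x * (LINT y:\<Omega>|lborel. indicator A y * J x y * (z t y - z t x))
       + exp (- t) * indicator A xb * indicator A x * J xb x
   + indicator B x * (LINT y:\<Omega>|lborel. indicator B y * G x y * (z t y - z t x))
       + exp (- t) * indicator B xb * indicator B x * G xb x
   + indicator A x * (LINT y:\<Omega>|lborel. indicator B y * R x y * (z t y - z t x))
       + exp (- t) * indicator A xb * indicator B x * R xb x
   + indicator B x * (LINT y:\<Omega>|lborel. indicator A y * R x y * (z t y - z t x))
       + exp (- t) * indicator B xb * indicator A x * R xb x"

text \<open>
  The two possible limit systems differ only in their source terms; \<open>Ka\<close> and \<open>Kb\<close> are the kernels
  occurring there: \<open>(J, R)\<close> in the first system and \<open>(R, G)\<close> in the second.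
\<close>

definition limit_rhs_a ::
  "'a::euclidean_space set \<Rightarrow> ('a \<Rightarrow> 'a \<Rightarrow> real) \<Rightarrow> ('a \<Rightarrow> 'a \<Rightarrow> real) \<Rightarrow> ('a \<Rightarrow> real) \<Rightarrow>
   ('a \<Rightarrow> 'a \<Rightarrow> real) \<Rightarrow> 'a \<Rightarrow> (real \<Rightarrow> 'a \<Rightarrow> real) \<Rightarrow> (real \<Rightarrow> 'a \<Rightarrow> real) \<Rightarrow> real \<Rightarrow> 'a \<Rightarrow> real" where
  "limit_rhs_a \<Omega> J R X Ka xb a b t x =
     (LINT y:\<Omega>|lborel. J x y * (X x * a t y - X y * a t x))
   + (LINT y:\<Omega>|lborel. R x y * (X x * b t y - (1 - X y) * a t x))
   + exp (- t) * Ka xb x * X x"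

definition limit_rhs_b ::
  "'a::euclidean_space set \<Rightarrow> ('a \<Rightarrow> 'a \<Rightarrow> real) \<Rightarrow> ('a \<Rightarrow> 'a \<Rightarrow> real) \<Rightarrow> ('a \<Rightarrow> real) \<Rightarrow>
   ('a \<Rightarrow> 'a \<Rightarrow> real) \<Rightarrow> 'a \<Rightarrow> (real \<Rightarrow> 'a \<Rightarrow> real) \<Rightarrow> (real \<Rightarrow> 'a \<Rightarrow> real) \<Rightarrow> real \<Rightarrow> 'a \<Rightarrow> real" where
  "limit_rhs_b \<Omega> G R X Kb xb a b t x =
     (LINT y:\<Omega>|lborel. G x y * ((1 - X x) * b t y - (1 - X y) * b t x))
   + (LINT y:\<Omega>|lborel. R x y * ((1 - X x) * a t y - X y * b t x))
   + exp (- t) * Kb xb x * (1 - X x)"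

definition limit_system ::
  "'a::euclidean_space set \<Rightarrow> ('a \<Rightarrow> 'a \<Rightarrow> real) \<Rightarrow> ('a \<Rightarrow> 'a \<Rightarrow> real) \<Rightarrow> ('a \<Rightarrow> 'a \<Rightarrow> real) \<Rightarrow>
   ('a \<Rightarrow> real) \<Rightarrow> ('a \<Rightarrow> 'a \<Rightarrow> real) \<Rightarrow> ('a \<Rightarrow> 'a \<Rightarrow> real) \<Rightarrow> 'a \<Rightarrow>
   (real \<Rightarrow> 'a \<Rightarrow> real) \<Rightarrow> (real \<Rightarrow> 'a \<Rightarrow> real) \<Rightarrow> bool" where
  "limit_system \<Omega> J G R X Ka Kb xb a b \<longleftrightarrow>
     solves_from_zero \<Omega> a (limit_rhs_a \<Omega> J R X Ka xb a b) \<and>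
     solves_from_zero \<Omega> b (limit_rhs_b \<Omega> G R X Kb xb a b)"

end

theory Submission
  imports Defs
begin

text \<open>
  The functions \<open>u\<^sub>n = \<chi>\<^bsub>A n\<^esub> z\<^sub>n\<close> and \<open>v\<^sub>n = \<chi>\<^bsub>B n\<^esub> z\<^sub>n\<close> solve a closed linear system. Because indicator
  functions are idempotent, it is the limit system itself, with \<open>\<chi>\<^bsub>A n\<^esub>\<close> in the place of \<open>X\<close>
  (\<open>jump_process_solves_mixture\<close>). The theorem therefore says that the solution of the limit system
  depends continuously on the volume fraction \<open>X\<close>, when \<open>X\<close> carries the weak-star topology. The
  source terms are the only other place where \<open>n\<close> enters: they are governed by the phase that
  contains the starting point \<open>xb\<close>. One of the two phases contains \<open>xb\<close> for infinitely many \<open>n\<close>; a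
  subsequence along which it does so fixes the source, and the phase decides which of the two limit
  systems appears.

  The system is an ordinary differential equation \<open>u' = L\<^sub>X u + e\<^sup>-\<^sup>t s\<^sub>X\<close> with a bounded operator
  \<open>L\<^sub>X\<close>, so its solution is a power series \<open>\<Sum>\<^sub>k c\<^sub>k(x) t\<^sup>k / k!\<close> with
  \<open>c\<^sub>0 = 0\<close> and \<open>c\<^sub>k\<^sub>+\<^sub>1 = L\<^sub>X c\<^sub>k + (-1)\<^sup>k s\<^sub>X\<close>, where \<open>|c\<^sub>k| \<le> D\<^sup>k\<close> with \<open>D\<close> independent of \<open>X\<close>
  (\<open>coef_bounded\<close>, \<open>flow_solves\<close>). An energy estimate and Gronwall's inequality show that there is
  no other solution in \<open>L\<^sup>2\<close> (\<open>solves_mixture_unique\<close>), so the given \<open>z\<^sub>n\<close> is almost everywhere equal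
  to its series.

  Passing to the limit is then done coefficient by coefficient (\<open>coef_weak_star\<close>). The operator
  \<open>L\<^sub>X\<close> contains \<open>X\<close> and \<open>c\<^sub>k\<close> only in products of one of them with an integral of the other
  against a kernel. Integration against a kernel turns weak-star convergence into bounded pointwise
  convergence, and the product of a weak-star convergent sequence with a boundedly pointwise
  convergent one is weak-star convergent. The uniform bound on the coefficients allows summation of
  the limits by Tannery's theorem (\<open>flow_weak_convergence\<close>).

  Existence of the limit is thus a by-product of the explicit series. The two phases are treated
  as an arbitrary finite family indexed by a type \<open>'i\<close>, which makes the two equations
  of the system instances of a single one.
\<close>

section \<open>Exponential generating functions\<close>

text \<open>
  The exponential generating function of the sequence of time derivatives at \<open>0\<close>; all
  solutions below are built from it.
\<close>

definition egf :: "(nat \<Rightarrow> real) \<Rightarrow> real \<Rightarrow> real" where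
  "egf c t = (\<Sum>k. c k * t ^ k / fact k)"

lemma summable_geometric_over_fact: "summable (\<lambda>k. B * (D * r) ^ k / fact k :: real)"
proof -
  have "summable (\<lambda>k. B * (inverse (fact k) *\<^sub>R (D * r) ^ k))"
    by (intro summable_mult summable_exp_generic)
  then show ?thesis by (simp add: field_simps)
qed

text \<open>
  Geometric growth of the coefficients, with arbitrary prefactor \<open>B\<close>, is the class of sequences
  used throughout: it is stable under the shift, which differentiates \<open>egf\<close>.
\<close>

lemma egf_term_bound:
  fixes c :: "nat \<Rightarrow> real"
  assumes "\<And>k. \<bar>c k\<bar> \<le> B * D ^ k" and "\<bar>t\<bar> \<le> r"
  shows "\<bar>c k * t ^ k / fact k\<bar> \<le> B * (D * r) ^ k / fact k"
proof -
  have "\<bar>c k\<bar> * \<bar>t\<bar> ^ k \<le> (B * D ^ k) * r ^ k"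
    using assms order_trans[OF abs_ge_zero assms(1)] by (intro mult_mono power_mono) auto
  then show ?thesis
    by (simp add: abs_mult power_abs power_mult_distrib mult.assoc divide_right_mono)
qed

lemma egf_summable:
  fixes c :: "nat \<Rightarrow> real"
  assumes "\<And>k. \<bar>c k\<bar> \<le> B * D ^ k"
  shows "summable (\<lambda>k. c k * t ^ k / fact k)"
  by (rule summable_comparison_test'[OF summable_geometric_over_fact[of B D "\<bar>t\<bar>"]])
     (use egf_term_bound[OF assms order_refl] in \<open>simp add: abs_mult\<close>)

lemma egf_sums:
  fixes c :: "nat \<Rightarrow> real"
  assumes "\<And>k. \<bar>c k\<bar> \<le> B * D ^ k"
  shows "(\<lambda>k. c k * t ^ k / fact k) sums egf c t"
  unfolding egf_def using egf_summable[OF assms] by (rule summable_sums)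

lemma egf_bound:
  fixes c :: "nat \<Rightarrow> real"
  assumes "\<And>k. \<bar>c k\<bar> \<le> B * D ^ k" and "\<bar>t\<bar> \<le> r"
  shows "\<bar>egf c t\<bar> \<le> B * exp (D * r)"
proof -
  have "(\<lambda>k. B * ((D * r) ^ k /\<^sub>R fact k)) sums (B * exp (D * r))"
    by (intro sums_mult exp_converges)
  then have *: "(\<lambda>k. B * (D * r) ^ k / fact k) sums (B * exp (D * r))"
    by (simp add: field_simps)
  have "norm (egf c t) \<le> (\<Sum>k. B * (D * r) ^ k / fact k)"
    unfolding egf_def using egf_term_bound[OF assms] sums_summable[OF *]
    by (intro norm_suminf_le) simp_all
  then show ?thesis using sums_unique[OF *] by simp
qed

lemma egf_0 [simp]: "egf c 0 = c 0"
proof -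
  have "egf c 0 = (\<Sum>k. (c k / fact k) * 0 ^ k)" by (simp add: egf_def mult.commute)
  then show ?thesis by (simp only: powser_zero) simp
qed

lemma egf_exp_minus: "egf (\<lambda>k. (- 1) ^ k * s) t = exp (- t) * s"
proof -
  have "(\<lambda>k. s * ((- t) ^ k /\<^sub>R fact k)) sums (s * exp (- t))"
    by (intro sums_mult exp_converges)
  then have "(\<lambda>k. (- 1) ^ k * s * t ^ k / fact k) sums (exp (- t) * s)"
    by (simp add: power_minus[of t] field_simps)
  then show ?thesis unfolding egf_def by (rule sums_unique[symmetric])
qed

lemma egf_shift_bound:
  fixes c :: "nat \<Rightarrow> real"
  assumes "\<And>k. \<bar>c k\<bar> \<le> B * D ^ k"
  shows "\<bar>c (Suc k)\<bar> \<le> (B * D) * D ^ k"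
  using assms[of "Suc k"] by (simp add: mult.assoc)

lemma egf_deriv:
  fixes c :: "nat \<Rightarrow> real"
  assumes "\<And>k. \<bar>c k\<bar> \<le> B * D ^ k"
  shows "(egf c has_real_derivative egf (\<lambda>k. c (Suc k)) t) (at t)"
proof -
  have "((\<lambda>t. \<Sum>n. (c n / fact n) * t ^ n) has_real_derivative
          (\<Sum>n. diffs (\<lambda>n. c n / fact n) n * t ^ n)) (at t)"
    using egf_summable[OF assms] by (intro termdiffs_strong_converges_everywhere) simp
  moreover have "diffs (\<lambda>n. c n / fact n) n * t ^ n = c (Suc n) * t ^ n / fact n" for n
    by (simp add: diffs_def divide_simps del: of_nat_Suc)
  ultimately show ?thesis unfolding egf_def[abs_def] by simp
qed

lemma egf_lipschitz:
  fixes c :: "nat \<Rightarrow> real"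
  assumes "\<And>k. \<bar>c k\<bar> \<le> B * D ^ k" and "\<bar>s\<bar> \<le> r" and "\<bar>t\<bar> \<le> r"
  shows "\<bar>egf c s - egf c t\<bar> \<le> B * D * exp (D * r) * \<bar>s - t\<bar>"
proof -
  have "norm (egf c s - egf c t) \<le> B * D * exp (D * r) * norm (s - t)"
  proof (rule field_differentiable_bound[where S = "{-r..r}"])
    show "(egf c has_real_derivative egf (\<lambda>k. c (Suc k)) z) (at z within {-r..r})" for z
      by (rule has_field_derivative_at_within[OF egf_deriv[OF assms(1)]])
    show "norm (egf (\<lambda>k. c (Suc k)) z) \<le> B * D * exp (D * r)" if "z \<in> {-r..r}" for z
      using egf_bound[OF egf_shift_bound[OF assms(1)], of z r] that by auto
  qed (use assms in auto)
  then show ?thesis by simp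
qed

text \<open>
  The first-order Taylor remainder. The constant depends on the sequence only through its growth,
  so for coefficients that depend on \<open>x\<close> the difference quotients converge uniformly in \<open>x\<close>; this
  is what turns pointwise derivatives into derivatives in \<open>L\<^sup>2\<close>.
\<close>

lemma egf_difference_quotient:
  fixes c :: "nat \<Rightarrow> real"
  assumes "\<And>k. \<bar>c k\<bar> \<le> B * D ^ k" and "\<bar>s\<bar> \<le> r" and "\<bar>t\<bar> \<le> r" and "s \<noteq> t"
  shows "\<bar>(egf c s - egf c t) / (s - t) - egf (\<lambda>k. c (Suc k)) t\<bar>
           \<le> B * D * D * exp (D * r) * \<bar>s - t\<bar>"
proof -
  define c' where "c' = (\<lambda>k. c (Suc k))"
  define E where "E = B * D * D * exp (D * r)"
  have E: "\<bar>egf c' z - egf c' t\<bar> \<le> E * \<bar>z - t\<bar>" if "\<bar>z\<bar> \<le> r" for z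
    using egf_lipschitz[OF egf_shift_bound[OF assms(1)] that assms(3)] by (simp add: c'_def E_def)
  have "0 \<le> B * D ^ 2"
    using assms(1)[of 2] by linarith
  then have E0: "0 \<le> E" by (simp add: E_def power2_eq_square)
  have "norm ((egf c s - s * egf c' t) - (egf c t - t * egf c' t)) \<le> (E * \<bar>s - t\<bar>) * norm (s - t)"
  proof (rule field_differentiable_bound[where S = "closed_segment s t"])
    show "((\<lambda>z. egf c z - z * egf c' t) has_real_derivative (egf c' z - egf c' t))
            (at z within closed_segment s t)" for z
      unfolding c'_def
      by (rule has_field_derivative_at_within) (auto intro!: derivative_eq_intros egf_deriv[OF assms(1)])
    show "norm (egf c' z - egf c' t) \<le> E * \<bar>s - t\<bar>" if "z \<in> closed_segment s t" for z
    proof -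
      have "\<bar>z\<bar> \<le> r" "\<bar>z - t\<bar> \<le> \<bar>s - t\<bar>"
        using that assms(2,3) by (auto simp: closed_segment_eq_real_ivl split: if_splits)
      then show ?thesis using E[of z] E0 by (auto intro: order_trans mult_left_mono)
    qed
  qed auto
  then have "\<bar>egf c s - egf c t - (s - t) * egf c' t\<bar> \<le> E * \<bar>s - t\<bar> * \<bar>s - t\<bar>"
    by (simp add: algebra_simps)
  moreover have "(egf c s - egf c t) / (s - t) - egf c' t
      = (egf c s - egf c t - (s - t) * egf c' t) / (s - t)"
    using assms(4) by (simp add: field_simps)
  ultimately show ?thesis
    using assms(4) unfolding c'_def[symmetric] E_def[symmetric]
    by (simp add: abs_divide divide_le_eq)
qed

text \<open>
  Integration commutes with summation of the series because the terms are dominated by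
  \<open>|w|\<close> times the terms of an exponential series. The time \<open>\<tau> p\<close> may vary with the point, so that the
  result applies both at a fixed time and on space-time.
\<close>

lemma
  fixes c :: "nat \<Rightarrow> 'b \<Rightarrow> real"
  assumes w: "integrable \<nu> w" and c [measurable]: "\<And>k. c k \<in> borel_measurable \<nu>"
    and \<tau> [measurable]: "\<tau> \<in> borel_measurable \<nu>"
    and c_bound: "\<And>k p. p \<in> space \<nu> \<Longrightarrow> \<bar>c k p\<bar> \<le> B * D ^ k"
    and \<tau>_bound: "\<And>p. p \<in> space \<nu> \<Longrightarrow> \<bar>\<tau> p\<bar> \<le> r"
  shows egf_integral_sums: "(\<lambda>k. (\<integral>p. w p * (c k p * \<tau> p ^ k / fact k) \<partial>\<nu>)) sums
           (\<integral>p. w p * egf (\<lambda>k. c k p) (\<tau> p) \<partial>\<nu>)" (is ?sums)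
    and egf_integral_term_bound: "\<bar>\<integral>p. w p * (c k p * \<tau> p ^ k / fact k) \<partial>\<nu>\<bar>
           \<le> (\<integral>p. \<bar>w p\<bar> \<partial>\<nu>) * B * (D * r) ^ k / fact k" (is ?bound)
proof -
  have [measurable]: "w \<in> borel_measurable \<nu>" using w by auto
  define m where "m = (\<lambda>k. B * (D * r) ^ k / fact k)"
  have tb: "\<bar>w p * (c k p * \<tau> p ^ k / fact k)\<bar> \<le> \<bar>w p\<bar> * m k" if "p \<in> space \<nu>" for p k
    unfolding abs_mult[of "w p"] m_def
    by (intro mult_left_mono egf_term_bound[where c = "\<lambda>k. c k p"] c_bound \<tau>_bound that) auto
  have int: "integrable \<nu> (\<lambda>p. w p * (c k p * \<tau> p ^ k / fact k))" for k
  proof (rule Bochner_Integration.integrable_bound)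
    show "integrable \<nu> (\<lambda>p. \<bar>w p\<bar> * m k)" using w by auto
    show "AE p in \<nu>. norm (w p * (c k p * \<tau> p ^ k / fact k)) \<le> norm (\<bar>w p\<bar> * m k)"
      unfolding real_norm_def by (intro AE_I2 order_trans[OF tb abs_ge_self])
  qed simp
  have nb: "(\<integral>p. norm (w p * (c k p * \<tau> p ^ k / fact k)) \<partial>\<nu>) \<le> (\<integral>p. \<bar>w p\<bar> \<partial>\<nu>) * m k" for k
  proof -
    have "(\<integral>p. norm (w p * (c k p * \<tau> p ^ k / fact k)) \<partial>\<nu>) \<le> (\<integral>p. \<bar>w p\<bar> * m k \<partial>\<nu>)"
    proof (rule integral_mono)
      show "integrable \<nu> (\<lambda>p. norm (w p * (c k p * \<tau> p ^ k / fact k)))"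
        by (rule integrable_norm[OF int])
      show "integrable \<nu> (\<lambda>p. \<bar>w p\<bar> * m k)" using w by auto
      show "norm (w p * (c k p * \<tau> p ^ k / fact k)) \<le> \<bar>w p\<bar> * m k" if "p \<in> space \<nu>" for p
        using tb[OF that, of k] unfolding real_norm_def .
    qed
    then show ?thesis using w by simp
  qed
  have mterm: "(\<integral>p. \<bar>w p\<bar> \<partial>\<nu>) * m k = (\<integral>p. \<bar>w p\<bar> \<partial>\<nu>) * B * (D * r) ^ k / fact k" for k
    by (simp add: m_def)
  have sm: "summable (\<lambda>k. (\<integral>p. \<bar>w p\<bar> \<partial>\<nu>) * m k)"
    unfolding m_def by (intro summable_mult summable_geometric_over_fact)
  have "(\<lambda>k. (\<integral>p. w p * (c k p * \<tau> p ^ k / fact k) \<partial>\<nu>)) sums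
           (\<integral>p. (\<Sum>k. w p * (c k p * \<tau> p ^ k / fact k)) \<partial>\<nu>)"
  proof (rule sums_integral[OF int])
    show "AE p in \<nu>. summable (\<lambda>k. norm (w p * (c k p * \<tau> p ^ k / fact k)))"
    proof (rule AE_I2)
      fix p assume "p \<in> space \<nu>"
      have "summable (\<lambda>k. \<bar>w p\<bar> * m k)"
        unfolding m_def by (intro summable_mult summable_geometric_over_fact)
      then show "summable (\<lambda>k. norm (w p * (c k p * \<tau> p ^ k / fact k)))"
        by (rule summable_comparison_test')
           (simp only: real_norm_def abs_idempotent tb[OF \<open>p \<in> space \<nu>\<close>])
    qed
    show "summable (\<lambda>k. \<integral>p. norm (w p * (c k p * \<tau> p ^ k / fact k)) \<partial>\<nu>)"
    proof (rule summable_comparison_test'[OF sm])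
      fix k
      have "0 \<le> (\<integral>p. norm (w p * (c k p * \<tau> p ^ k / fact k)) \<partial>\<nu>)"
        by (rule Bochner_Integration.integral_nonneg) (rule norm_ge_zero)
      then show "norm (\<integral>p. norm (w p * (c k p * \<tau> p ^ k / fact k)) \<partial>\<nu>)
          \<le> (\<integral>p. \<bar>w p\<bar> \<partial>\<nu>) * m k"
        using nb[of k] by (simp only: real_norm_def abs_of_nonneg)
    qed
  qed
  moreover have "(\<integral>p. (\<Sum>k. w p * (c k p * \<tau> p ^ k / fact k)) \<partial>\<nu>)
      = (\<integral>p. w p * egf (\<lambda>k. c k p) (\<tau> p) \<partial>\<nu>)"
  proof (intro Bochner_Integration.integral_cong refl)
    fix p assume "p \<in> space \<nu>"
    then show "(\<Sum>k. w p * (c k p * \<tau> p ^ k / fact k)) = w p * egf (\<lambda>k. c k p) (\<tau> p)"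
      unfolding egf_def by (intro suminf_mult egf_summable) (rule c_bound)
  qed
  ultimately show ?sums by simp
  have "norm (\<integral>p. w p * (c k p * \<tau> p ^ k / fact k) \<partial>\<nu>)
      \<le> (\<integral>p. norm (w p * (c k p * \<tau> p ^ k / fact k)) \<partial>\<nu>)"
    by (rule integral_norm_bound)
  from order_trans[OF this nb[of k]] show ?bound
    by (simp only: real_norm_def mterm)
qed

section \<open>Square-integrable functions\<close>

definition sq_integrable :: "'b measure \<Rightarrow> ('b \<Rightarrow> real) \<Rightarrow> bool" where
  "sq_integrable \<nu> f \<longleftrightarrow> f \<in> borel_measurable \<nu> \<and> integrable \<nu> (\<lambda>x. (f x)\<^sup>2)"

lemma sq_integrable_measurable: "sq_integrable \<nu> f \<Longrightarrow> f \<in> borel_measurable \<nu>"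
  by (simp add: sq_integrable_def)

lemma sq_integrable_square: "sq_integrable \<nu> f \<Longrightarrow> integrable \<nu> (\<lambda>x. (f x)\<^sup>2)"
  by (simp add: sq_integrable_def)

lemma sq_integrable_mult:
  assumes f: "sq_integrable \<nu> f" and g: "sq_integrable \<nu> g"
  shows "integrable \<nu> (\<lambda>x. f x * g x)"
proof (rule Bochner_Integration.integrable_bound)
  show "integrable \<nu> (\<lambda>x. (f x)\<^sup>2 + (g x)\<^sup>2)"
    using f g by (intro Bochner_Integration.integrable_add sq_integrable_square)
  show "(\<lambda>x. f x * g x) \<in> borel_measurable \<nu>"
    using f g by (intro borel_measurable_times sq_integrable_measurable)
  have "\<bar>f x * g x\<bar> \<le> (f x)\<^sup>2 + (g x)\<^sup>2" for x
  proof -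
    have "2 * (\<bar>f x\<bar> * \<bar>g x\<bar>) \<le> (f x)\<^sup>2 + (g x)\<^sup>2"
      using sum_squares_bound[of "\<bar>f x\<bar>" "\<bar>g x\<bar>"] by simp
    moreover have "0 \<le> \<bar>f x\<bar> * \<bar>g x\<bar>" by simp
    ultimately have "\<bar>f x\<bar> * \<bar>g x\<bar> \<le> (f x)\<^sup>2 + (g x)\<^sup>2" by linarith
    then show ?thesis by (simp add: abs_mult)
  qed
  then show "AE x in \<nu>. norm (f x * g x) \<le> norm ((f x)\<^sup>2 + (g x)\<^sup>2)" by simp
qed

lemma sq_integrable_cmult: "sq_integrable \<nu> f \<Longrightarrow> sq_integrable \<nu> (\<lambda>x. c * f x)"
  by (auto simp: sq_integrable_def power_mult_distrib)

lemma sq_integrable_add: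
  assumes "sq_integrable \<nu> f" and "sq_integrable \<nu> g"
  shows "sq_integrable \<nu> (\<lambda>x. f x + g x)"
proof -
  have "integrable \<nu> (\<lambda>x. (f x)\<^sup>2 + (g x)\<^sup>2 + 2 * (f x * g x))"
    using assms by (intro Bochner_Integration.integrable_add integrable_mult_right
      sq_integrable_square sq_integrable_mult)
  then show ?thesis
    using assms by (auto simp: sq_integrable_def power2_sum mult.assoc)
qed

lemma sq_integrable_diff:
  assumes "sq_integrable \<nu> f" and "sq_integrable \<nu> g"
  shows "sq_integrable \<nu> (\<lambda>x. f x - g x)"
  using sq_integrable_add[OF assms(1) sq_integrable_cmult[OF assms(2), of "-1"]] by simp

lemma sq_integrable_bounded_mult:
  assumes f: "sq_integrable \<nu> f" and c [measurable]: "c \<in> borel_measurable \<nu>"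
    and b: "\<And>x. x \<in> space \<nu> \<Longrightarrow> \<bar>c x\<bar> \<le> B"
  shows "sq_integrable \<nu> (\<lambda>x. c x * f x)"
  unfolding sq_integrable_def
proof
  have [measurable]: "f \<in> borel_measurable \<nu>" using f by (rule sq_integrable_measurable)
  show "(\<lambda>x. c x * f x) \<in> borel_measurable \<nu>" by simp
  show "integrable \<nu> (\<lambda>x. (c x * f x)\<^sup>2)"
  proof (rule Bochner_Integration.integrable_bound)
    show "integrable \<nu> (\<lambda>x. B\<^sup>2 * (f x)\<^sup>2)"
      using f by (intro integrable_mult_right sq_integrable_square)
    have "(c x * f x)\<^sup>2 \<le> B\<^sup>2 * (f x)\<^sup>2" if "x \<in> space \<nu>" for x
      unfolding power_mult_distrib using power_mono[OF b[OF that], of 2]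
      by (intro mult_right_mono) auto
    then show "AE x in \<nu>. norm ((c x * f x)\<^sup>2) \<le> norm (B\<^sup>2 * (f x)\<^sup>2)" by (intro AE_I2) simp
  qed simp
qed

lemma (in finite_measure) sq_integrable_bounded:
  assumes "f \<in> borel_measurable M" and "AE x in M. \<bar>f x\<bar> \<le> B"
  shows "sq_integrable M f"
  unfolding sq_integrable_def
proof
  show "integrable M (\<lambda>x. (f x)\<^sup>2)"
  proof (rule integrable_const_bound)
    show "AE x in M. norm ((f x)\<^sup>2) \<le> B\<^sup>2"
      using assms(2)
    proof eventually_elim
      case (elim x)
      then show ?case using power_mono[of "\<bar>f x\<bar>" B 2] by simp
    qed
  qed (use assms(1) in simp)
qed (rule assms(1))

lemma (in finite_measure) sq_integrable_integrable: "sq_integrable M f \<Longrightarrow> integrable M f"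
  using sq_integrable_mult[of M f "\<lambda>_. 1"] sq_integrable_bounded[of "\<lambda>_. 1" 1] by simp

text \<open>
  The usual discriminant argument for the nonnegative quadratic form
  \<open>(s, u) \<mapsto> \<integral>(s f + u g)\<^sup>2\<close>.
\<close>

lemma Cauchy_Schwarz_integral:
  assumes f: "sq_integrable \<nu> f" and g: "sq_integrable \<nu> g"
  shows "(\<integral>x. f x * g x \<partial>\<nu>)\<^sup>2 \<le> (\<integral>x. (f x)\<^sup>2 \<partial>\<nu>) * (\<integral>x. (g x)\<^sup>2 \<partial>\<nu>)"
proof -
  define a b c where "a = (\<integral>x. (f x)\<^sup>2 \<partial>\<nu>)" and "b = (\<integral>x. f x * g x \<partial>\<nu>)"
    and "c = (\<integral>x. (g x)\<^sup>2 \<partial>\<nu>)"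
  have i: "integrable \<nu> (\<lambda>x. (f x)\<^sup>2)" "integrable \<nu> (\<lambda>x. f x * g x)" "integrable \<nu> (\<lambda>x. (g x)\<^sup>2)"
    using f g by (auto intro: sq_integrable_square sq_integrable_mult)
  have q: "0 \<le> s\<^sup>2 * a + 2 * (s * u) * b + u\<^sup>2 * c" for s u
  proof -
    have "0 \<le> (\<integral>x. (s * f x + u * g x)\<^sup>2 \<partial>\<nu>)" by simp
    also have "\<dots> = (\<integral>x. s\<^sup>2 * (f x)\<^sup>2 + 2 * (s * u) * (f x * g x) + u\<^sup>2 * (g x)\<^sup>2 \<partial>\<nu>)"
      by (simp add: power2_sum power_mult_distrib mult_ac add_ac)
    also have "\<dots> = s\<^sup>2 * a + 2 * (s * u) * b + u\<^sup>2 * c"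
      unfolding a_def b_def c_def using i by simp
    finally show ?thesis .
  qed
  have nn: "0 \<le> a" "0 \<le> c" by (simp_all add: a_def c_def)
  have "b\<^sup>2 \<le> a * c"
  proof (cases "c = 0")
    case True
    \<comment> \<open>For \<open>c = 0\<close> the form is affine in \<open>u\<close>; a nonzero slope would make it negative at the chosen point.\<close>
    have "b = 0"
    proof (rule ccontr)
      assume "b \<noteq> 0"
      then show False using q[of 1 "- (a + 1) / (2 * b)"] True by (simp add: field_simps)
    qed
    then show ?thesis using nn by simp
  next
    case False
    then have "0 < c" using nn by simp
    have "0 \<le> c * (a * c - b\<^sup>2)"
      using q[of c "- b"] by (simp add: power2_eq_square algebra_simps)
    then show ?thesis using \<open>0 < c\<close> by (simp add: zero_le_mult_iff)
  qed
  then show ?thesis by (simp add: a_def b_def c_def)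
qed

lemma (in finite_measure) square_integral_le:
  assumes "sq_integrable M f"
  shows "(\<integral>x. \<bar>f x\<bar> \<partial>M)\<^sup>2 \<le> measure M (space M) * (\<integral>x. (f x)\<^sup>2 \<partial>M)"
proof -
  have "sq_integrable M (\<lambda>x. \<bar>f x\<bar>)" using assms by (auto simp: sq_integrable_def)
  from Cauchy_Schwarz_integral[OF this sq_integrable_bounded[of "\<lambda>_. 1" 1]] show ?thesis
    by (simp add: mult.commute)
qed

lemma sq_norm_add_le:
  assumes "sq_integrable \<nu> f" and "sq_integrable \<nu> g"
  shows "(\<integral>x. (f x + g x)\<^sup>2 \<partial>\<nu>) \<le> 2 * (\<integral>x. (f x)\<^sup>2 \<partial>\<nu>) + 2 * (\<integral>x. (g x)\<^sup>2 \<partial>\<nu>)"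
proof -
  have "(\<integral>x. (f x + g x)\<^sup>2 \<partial>\<nu>) \<le> (\<integral>x. 2 * (f x)\<^sup>2 + 2 * (g x)\<^sup>2 \<partial>\<nu>)"
  proof (rule integral_mono)
    fix x show "(f x + g x)\<^sup>2 \<le> 2 * (f x)\<^sup>2 + 2 * (g x)\<^sup>2"
      using sum_squares_bound[of "f x" "g x"] by (simp add: power2_sum)
  qed (intro sq_integrable_square sq_integrable_add assms Bochner_Integration.integrable_add
      integrable_mult_right)+
  also have "\<dots> = 2 * (\<integral>x. (f x)\<^sup>2 \<partial>\<nu>) + 2 * (\<integral>x. (g x)\<^sup>2 \<partial>\<nu>)"
    using assms by (simp add: sq_integrable_square)
  finally show ?thesis .
qed

text \<open>
  A function of time that is differentiable in \<open>L\<^sup>2\<close> has a differentiable squared norm. With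
  \<open>w s = w t + (s - t) (F + e)\<close> the squared norm is expanded; the error \<open>e\<close> tends to \<open>0\<close> in \<open>L\<^sup>2\<close>, so by
  Cauchy-Schwarz only the term \<open>2 (s - t) \<integral>F w\<close> survives at first order.
\<close>

lemma sq_norm_has_derivative:
  assumes w: "\<And>s. s > 0 \<Longrightarrow> sq_integrable \<nu> (w s)" and F: "sq_integrable \<nu> F" and t: "t > 0"
    and lim: "((\<lambda>s. \<integral>x. ((w s x - w t x) / (s - t) - F x)\<^sup>2 \<partial>\<nu>) \<longlongrightarrow> 0) (at t)"
  shows "((\<lambda>s. \<integral>x. (w s x)\<^sup>2 \<partial>\<nu>) has_real_derivative 2 * (\<integral>x. F x * w t x \<partial>\<nu>)) (at t)"
proof -
  define e where "e = (\<lambda>s x. (w s x - w t x) / (s - t) - F x)"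
  define Q where "Q = (\<lambda>s. \<integral>x. (e s x)\<^sup>2 \<partial>\<nu>)"
  have pos: "\<forall>\<^sub>F s in at t. s > 0 \<and> s \<noteq> t"
    using t by (auto simp: eventually_at intro!: exI[of _ t] simp: dist_real_def)
  have e: "sq_integrable \<nu> (e s)" if "s > 0" for s
    using sq_integrable_diff[OF sq_integrable_cmult[OF sq_integrable_diff[OF w[OF that] w[OF t]],
        of "inverse (s - t)"] F]
    by (simp add: e_def divide_inverse mult.commute)
  have Q: "(Q \<longlongrightarrow> 0) (at t)" using lim by (simp add: Q_def e_def)
  have cross: "((\<lambda>s. \<integral>x. w t x * e s x \<partial>\<nu>) \<longlongrightarrow> 0) (at t)"
  proof (rule Lim_null_comparison)
    show "\<forall>\<^sub>F s in at t. norm (\<integral>x. w t x * e s x \<partial>\<nu>) \<le> sqrt ((\<integral>x. (w t x)\<^sup>2 \<partial>\<nu>) * Q s)"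
      using pos
    proof eventually_elim
      case (elim s)
      then show ?case
        using Cauchy_Schwarz_integral[OF w[OF t] e[of s]]
        by (auto simp: Q_def intro!: real_le_rsqrt)
    qed
    show "((\<lambda>s. sqrt ((\<integral>x. (w t x)\<^sup>2 \<partial>\<nu>) * Q s)) \<longlongrightarrow> 0) (at t)"
      using tendsto_real_sqrt[OF tendsto_mult[OF tendsto_const Q]] by simp
  qed
  have quad: "((\<lambda>s. (s - t) * (\<integral>x. (F x + e s x)\<^sup>2 \<partial>\<nu>)) \<longlongrightarrow> 0) (at t)"
  proof (rule Lim_null_comparison)
    show "\<forall>\<^sub>F s in at t. norm ((s - t) * (\<integral>x. (F x + e s x)\<^sup>2 \<partial>\<nu>))
            \<le> \<bar>s - t\<bar> * (2 * (\<integral>x. (F x)\<^sup>2 \<partial>\<nu>) + 2 * Q s)"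
      using pos
    proof eventually_elim
      case (elim s)
      then show ?case
        using sq_norm_add_le[OF F e[of s]]
        by (auto simp: Q_def abs_mult intro!: mult_left_mono)
    qed
    have "((\<lambda>s. \<bar>s - t\<bar> * (2 * (\<integral>x. (F x)\<^sup>2 \<partial>\<nu>) + 2 * Q s))
            \<longlongrightarrow> \<bar>t - t\<bar> * (2 * (\<integral>x. (F x)\<^sup>2 \<partial>\<nu>) + 2 * 0)) (at t)"
      by (intro tendsto_intros Q)
    then show "((\<lambda>s. \<bar>s - t\<bar> * (2 * (\<integral>x. (F x)\<^sup>2 \<partial>\<nu>) + 2 * Q s)) \<longlongrightarrow> 0) (at t)" by simp
  qed
  have "((\<lambda>s. 2 * (\<integral>x. F x * w t x \<partial>\<nu>) + 2 * (\<integral>x. w t x * e s x \<partial>\<nu>)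
            + (s - t) * (\<integral>x. (F x + e s x)\<^sup>2 \<partial>\<nu>)) \<longlongrightarrow> 2 * (\<integral>x. F x * w t x \<partial>\<nu>) + 2 * 0 + 0) (at t)"
    by (intro tendsto_intros cross quad)
  moreover have "\<forall>\<^sub>F s in at t. 2 * (\<integral>x. F x * w t x \<partial>\<nu>) + 2 * (\<integral>x. w t x * e s x \<partial>\<nu>)
            + (s - t) * (\<integral>x. (F x + e s x)\<^sup>2 \<partial>\<nu>)
          = ((\<integral>x. (w s x)\<^sup>2 \<partial>\<nu>) - (\<integral>x. (w t x)\<^sup>2 \<partial>\<nu>)) / (s - t)"
    using pos
  proof eventually_elim
    case (elim s)
    have i: "integrable \<nu> (\<lambda>x. (w t x)\<^sup>2)" "integrable \<nu> (\<lambda>x. F x * w t x)"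
        "integrable \<nu> (\<lambda>x. w t x * e s x)" "integrable \<nu> (\<lambda>x. (F x + e s x)\<^sup>2)"
      using e[of s] F w[OF t] elim
      by (auto intro: sq_integrable_square sq_integrable_mult sq_integrable_add)
    have "w s x = w t x + (s - t) * (F x + e s x)" for x
      using elim by (simp add: e_def)
    then have "(w s x)\<^sup>2 = (w t x)\<^sup>2 + (2 * (s - t)) * (F x * w t x)
        + (2 * (s - t)) * (w t x * e s x) + (s - t)\<^sup>2 * (F x + e s x)\<^sup>2" for x
      by (simp only:) (simp add: power2_eq_square algebra_simps)
    then have "(\<integral>x. (w s x)\<^sup>2 \<partial>\<nu>) = (\<integral>x. (w t x)\<^sup>2 + (2 * (s - t)) * (F x * w t x)
        + (2 * (s - t)) * (w t x * e s x) + (s - t)\<^sup>2 * (F x + e s x)\<^sup>2 \<partial>\<nu>)"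
      by (simp only:)
    also have "\<dots> = (\<integral>x. (w t x)\<^sup>2 \<partial>\<nu>) + (2 * (s - t)) * (\<integral>x. F x * w t x \<partial>\<nu>)
        + (2 * (s - t)) * (\<integral>x. w t x * e s x \<partial>\<nu>) + (s - t)\<^sup>2 * (\<integral>x. (F x + e s x)\<^sup>2 \<partial>\<nu>)"
      using i by simp
    finally show ?case using elim by (simp add: field_simps power2_eq_square)
  qed
  ultimately have "((\<lambda>s. ((\<integral>x. (w s x)\<^sup>2 \<partial>\<nu>) - (\<integral>x. (w t x)\<^sup>2 \<partial>\<nu>)) / (s - t))
      \<longlongrightarrow> 2 * (\<integral>x. F x * w t x \<partial>\<nu>)) (at t)"
    by (simp add: filterlim_cong[OF refl refl])
  then show ?thesis by (simp add: has_field_derivative_iff)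
qed

text \<open>
  The function \<open>e\<^sup>-\<^sup>C\<^sup>t E t\<close> is nonincreasing and tends to \<open>0\<close> at the origin. Differentiability is
  available only at positive times, so the initial value enters as a limit.
\<close>

lemma Gronwall_zero:
  fixes E E' :: "real \<Rightarrow> real"
  assumes deriv: "\<And>t. t > 0 \<Longrightarrow> (E has_real_derivative E' t) (at t)"
    and le: "\<And>t. t > 0 \<Longrightarrow> E' t \<le> C * E t" and nonneg: "\<And>t. t > 0 \<Longrightarrow> 0 \<le> E t"
    and lim: "(E \<longlongrightarrow> 0) (at_right 0)" and t: "t > 0"
  shows "E t = 0"
proof -
  define H where "H = (\<lambda>s. exp (- C * s) * E s)"
  have mono: "H t \<le> H s" if "0 < s" "s \<le> t" for s
  proof (rule DERIV_nonpos_imp_nonincreasing[OF that(2)])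
    fix x assume "s \<le> x" "x \<le> t"
    with that have x: "0 < x" by simp
    have "(H has_real_derivative exp (- C * x) * (E' x - C * E x)) (at x)"
      unfolding H_def by (auto intro!: derivative_eq_intros deriv x simp: algebra_simps)
    moreover have "exp (- C * x) * (E' x - C * E x) \<le> 0"
      using le[OF x] by (simp add: mult_le_0_iff)
    ultimately show "\<exists>y. (H has_real_derivative y) (at x) \<and> y \<le> 0" by blast
  qed
  have "(H \<longlongrightarrow> exp (- C * 0) * 0) (at_right 0)"
    unfolding H_def by (intro tendsto_intros lim)
  then have "(H \<longlongrightarrow> 0) (at_right 0)" by simp
  then have "H t \<le> 0"
  proof (rule tendsto_lowerbound)
    show "\<forall>\<^sub>F s in at_right 0. H t \<le> H s"
      unfolding eventually_at_right_field using mono t by (intro exI[of _ t]) auto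
  qed simp
  then have "E t \<le> 0" by (simp add: H_def mult_le_0_iff)
  with nonneg[OF t] show ?thesis by simp
qed

section \<open>The exchange operator of a mixture and uniqueness\<close>

text \<open>
  A finite family of phases \<open>'i\<close> shares the space \<open>\<mu>\<close>; \<open>K i j x y\<close> is the rate of jumps between \<open>x\<close> in
  phase \<open>i\<close> and \<open>y\<close> in phase \<open>j\<close>.
\<close>

locale mixture = finite_measure \<mu> for \<mu> :: "'a measure" +
  fixes K :: "'i::finite \<Rightarrow> 'i \<Rightarrow> 'a \<Rightarrow> 'a \<Rightarrow> real" and \<kappa> :: real
  assumes K_measurable: "case_prod (K i j) \<in> borel_measurable (\<mu> \<Otimes>\<^sub>M \<mu>)"
    and K_bound: "x \<in> space \<mu> \<Longrightarrow> y \<in> space \<mu> \<Longrightarrow> \<bar>K i j x y\<bar> \<le> \<kappa>"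
    and \<kappa>_nonneg: "0 \<le> \<kappa>"
begin

text \<open>
  With the mass densities of the phases as \<open>f\<close>, this is the rate at which mass is offered to phase
  \<open>i\<close> at \<open>x\<close>. With the volume fractions as \<open>f\<close>, the same expression is the total rate of jumps out of
  \<open>x\<close> in phase \<open>i\<close>. This double use is why \<open>exchange\<close> is defined through it.
\<close>

definition gain :: "('i \<Rightarrow> 'a \<Rightarrow> real) \<Rightarrow> 'i \<Rightarrow> 'a \<Rightarrow> real" where
  "gain f i x = (\<Sum>j\<in>UNIV. \<integral>y. K i j x y * f j y \<partial>\<mu>)"

text \<open>
  The right-hand side of the evolution equation without its source: an offered particle is
  accepted with probability \<open>\<theta> i x\<close>, the local volume fraction of the phase. The form as an integral of
  \<open>K i j x y * (\<theta> i x * f j y - \<theta> j y * f i x)\<close> is \<open>exchange_eq_integral\<close>; keeping the two products apart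
  is what makes the weak-star limit accessible.
\<close>

definition exchange :: "('i \<Rightarrow> 'a \<Rightarrow> real) \<Rightarrow> ('i \<Rightarrow> 'a \<Rightarrow> real) \<Rightarrow> 'i \<Rightarrow> 'a \<Rightarrow> real" where
  "exchange \<theta> f i x = \<theta> i x * gain f i x - f i x * gain \<theta> i x"

definition bounded_family :: "real \<Rightarrow> ('i \<Rightarrow> 'a \<Rightarrow> real) \<Rightarrow> bool" where
  "bounded_family c f \<longleftrightarrow> (\<forall>i. f i \<in> borel_measurable \<mu> \<and> (\<forall>x\<in>space \<mu>. \<bar>f i x\<bar> \<le> c))"

lemma bounded_familyD:
  assumes "bounded_family c f"
  shows "f i \<in> borel_measurable \<mu>" and "x \<in> space \<mu> \<Longrightarrow> \<bar>f i x\<bar> \<le> c"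
  using assms by (auto simp: bounded_family_def)

lemma bounded_family_integrable: "bounded_family c f \<Longrightarrow> integrable \<mu> (f i)"
  by (rule integrable_const_bound[where B = c]) (auto simp: bounded_family_def)

lemma K_section_measurable: "x \<in> space \<mu> \<Longrightarrow> K i j x \<in> borel_measurable \<mu>"
  using measurable_Pair2[OF K_measurable] by simp

lemma K_mult_integrable:
  assumes "integrable \<mu> f" and x: "x \<in> space \<mu>"
  shows "integrable \<mu> (\<lambda>y. K i j x y * f y)"
proof (rule Bochner_Integration.integrable_bound)
  show "integrable \<mu> (\<lambda>y. \<kappa> * f y)" using assms by simp
  show "(\<lambda>y. K i j x y * f y) \<in> borel_measurable \<mu>"
    using assms by (intro borel_measurable_times K_section_measurable) auto
  have "\<bar>K i j x y\<bar> * \<bar>f y\<bar> \<le> \<kappa> * \<bar>f y\<bar>" if "y \<in> space \<mu>" for y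
    using K_bound[OF x that] by (intro mult_right_mono) auto
  then show "AE y in \<mu>. norm (K i j x y * f y) \<le> norm (\<kappa> * f y)"
    using \<kappa>_nonneg by (intro AE_I2) (simp add: abs_mult)
qed

lemma gain_measurable:
  assumes "\<And>j. f j \<in> borel_measurable \<mu>"
  shows "gain f i \<in> borel_measurable \<mu>"
  unfolding gain_def[abs_def]
proof (intro borel_measurable_sum borel_measurable_lebesgue_integral)
  fix j
  have "(\<lambda>p. case_prod (K i j) p * f j (snd p)) \<in> borel_measurable (\<mu> \<Otimes>\<^sub>M \<mu>)"
    by (intro borel_measurable_times K_measurable measurable_compose[OF measurable_snd assms])
  then show "(\<lambda>(x, y). K i j x y * f j y) \<in> borel_measurable (\<mu> \<Otimes>\<^sub>M \<mu>)"
    by (simp add: split_beta')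
qed

lemma gain_bound:
  assumes f: "\<And>j. integrable \<mu> (f j)" and x: "x \<in> space \<mu>"
  shows "\<bar>gain f i x\<bar> \<le> \<kappa> * (\<Sum>j\<in>UNIV. \<integral>y. \<bar>f j y\<bar> \<partial>\<mu>)"
proof -
  have "\<bar>\<integral>y. K i j x y * f j y \<partial>\<mu>\<bar> \<le> \<kappa> * (\<integral>y. \<bar>f j y\<bar> \<partial>\<mu>)" for j
  proof -
    have "\<bar>\<integral>y. K i j x y * f j y \<partial>\<mu>\<bar> \<le> (\<integral>y. \<bar>K i j x y * f j y\<bar> \<partial>\<mu>)"
      by (rule integral_abs_bound)
    also have "\<dots> \<le> (\<integral>y. \<kappa> * \<bar>f j y\<bar> \<partial>\<mu>)"
    proof (rule integral_mono)
      show "integrable \<mu> (\<lambda>y. \<bar>K i j x y * f j y\<bar>)"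
        by (rule integrable_abs[OF K_mult_integrable[OF f x]])
      show "integrable \<mu> (\<lambda>y. \<kappa> * \<bar>f j y\<bar>)" using f by auto
      show "\<bar>K i j x y * f j y\<bar> \<le> \<kappa> * \<bar>f j y\<bar>" if "y \<in> space \<mu>" for y
        unfolding abs_mult by (intro mult_right_mono K_bound x that) simp
    qed
    finally show ?thesis by simp
  qed
  then have "(\<Sum>j\<in>UNIV. \<bar>\<integral>y. K i j x y * f j y \<partial>\<mu>\<bar>) \<le> (\<Sum>j\<in>UNIV. \<kappa> * (\<integral>y. \<bar>f j y\<bar> \<partial>\<mu>))"
    by (intro sum_mono)
  then show ?thesis
    unfolding gain_def sum_distrib_left by (rule order_trans[OF sum_abs])
qed

definition gain_rate :: real where
  "gain_rate = \<kappa> * (real CARD('i) * measure \<mu> (space \<mu>))"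

lemma gain_rate_nonneg: "0 \<le> gain_rate"
  using \<kappa>_nonneg by (simp add: gain_rate_def)

lemma gain_bounded:
  assumes f: "bounded_family c f" and x: "x \<in> space \<mu>"
  shows "\<bar>gain f i x\<bar> \<le> gain_rate * c"
proof -
  have "(\<integral>y. \<bar>f j y\<bar> \<partial>\<mu>) \<le> (\<integral>y. c \<partial>\<mu>)" for j
    using bounded_family_integrable[OF f] bounded_familyD(2)[OF f] by (intro integral_mono) auto
  then have "(\<Sum>j\<in>(UNIV :: 'i set). \<integral>y. \<bar>f j y\<bar> \<partial>\<mu>) \<le> (\<Sum>j\<in>(UNIV :: 'i set). \<integral>y. c \<partial>\<mu>)"
    by (intro sum_mono)
  then have "\<kappa> * (\<Sum>j\<in>(UNIV :: 'i set). \<integral>y. \<bar>f j y\<bar> \<partial>\<mu>) \<le> gain_rate * c"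
    using \<kappa>_nonneg by (auto simp: gain_rate_def mult_ac dest: mult_left_mono)
  with gain_bound[of f, OF bounded_family_integrable[OF f] x, of i] show ?thesis by linarith
qed

lemma exchange_measurable:
  assumes "\<And>j. \<theta> j \<in> borel_measurable \<mu>" and "\<And>j. f j \<in> borel_measurable \<mu>"
  shows "exchange \<theta> f i \<in> borel_measurable \<mu>"
  unfolding exchange_def[abs_def]
  by (intro borel_measurable_diff borel_measurable_times gain_measurable assms)

lemma exchange_bounded:
  assumes \<theta>: "bounded_family 1 \<theta>" and f: "bounded_family c f" and x: "x \<in> space \<mu>"
  shows "\<bar>exchange \<theta> f i x\<bar> \<le> 2 * gain_rate * c"
proof -
  have c: "0 \<le> c" using bounded_familyD(2)[OF f x, of i] by simp
  have "\<bar>\<theta> i x * gain f i x\<bar> \<le> 1 * (gain_rate * c)"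
    unfolding abs_mult by (intro mult_mono bounded_familyD(2)[OF \<theta> x] gain_bounded[OF f x]) auto
  moreover have "\<bar>f i x * gain \<theta> i x\<bar> \<le> c * (gain_rate * 1)"
    unfolding abs_mult using c
    by (intro mult_mono bounded_familyD(2)[OF f x] gain_bounded[OF \<theta> x]) auto
  ultimately show ?thesis unfolding exchange_def by (simp add: algebra_simps)
qed

lemma gain_diff:
  assumes "\<And>j. integrable \<mu> (f j)" and "\<And>j. integrable \<mu> (g j)" and "x \<in> space \<mu>"
  shows "gain (\<lambda>j y. f j y - g j y) i x = gain f i x - gain g i x"
  unfolding gain_def sum_subtractf[symmetric]
  using K_mult_integrable[OF _ assms(3)] assms(1,2)
  by (intro sum.cong refl) (simp add: right_diff_distrib)

lemma exchange_diff:
  assumes "\<And>j. integrable \<mu> (f j)" and "\<And>j. integrable \<mu> (g j)" and "x \<in> space \<mu>"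
  shows "exchange \<theta> (\<lambda>j y. f j y - g j y) i x = exchange \<theta> f i x - exchange \<theta> g i x"
  unfolding exchange_def by (simp add: gain_diff[OF assms] algebra_simps)

text \<open>
  The kernels are bounded, so \<open>gain w\<close> is bounded by the \<open>L\<^sup>1\<close> norms of \<open>w\<close>, which on a finite measure
  space are controlled by the \<open>L\<^sup>2\<close> norms.
\<close>

lemma energy_estimate:
  assumes \<theta>: "bounded_family 1 \<theta>" and w: "\<And>i. sq_integrable \<mu> (w i)"
  shows "sq_integrable \<mu> (exchange \<theta> w i)"
    and "(\<Sum>i\<in>UNIV. \<integral>x. exchange \<theta> w i x * w i x \<partial>\<mu>)
           \<le> 2 * gain_rate * (\<Sum>i\<in>UNIV. \<integral>x. (w i x)\<^sup>2 \<partial>\<mu>)"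
proof -
  define V where "V = measure \<mu> (space \<mu>)"
  define I where "I = (\<lambda>i. \<integral>x. \<bar>w i x\<bar> \<partial>\<mu>)"
  define N where "N = (\<lambda>i. \<integral>x. (w i x)\<^sup>2 \<partial>\<mu>)"
  have int: "integrable \<mu> (w i)" for i by (rule sq_integrable_integrable[OF w])
  have int2: "integrable \<mu> (\<lambda>x. (w i x)\<^sup>2)" for i by (rule sq_integrable_square[OF w])
  have m: "w i \<in> borel_measurable \<mu>" for i using int by auto
  have \<theta>m: "\<theta> i \<in> borel_measurable \<mu>" for i by (rule bounded_familyD(1)[OF \<theta>])
  have Esq: "sq_integrable \<mu> (exchange \<theta> w i)" for i
    unfolding exchange_def[abs_def]
  proof (rule sq_integrable_diff)
    have "\<bar>\<theta> i x * gain w i x\<bar> \<le> 1 * (\<kappa> * (\<Sum>j\<in>UNIV. I j))" if "x \<in> space \<mu>" for x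
      unfolding abs_mult I_def
      by (intro mult_mono bounded_familyD(2)[OF \<theta> that] gain_bound int that) auto
    then show "sq_integrable \<mu> (\<lambda>x. \<theta> i x * gain w i x)"
      by (intro sq_integrable_bounded[where B = "1 * (\<kappa> * (\<Sum>j\<in>UNIV. I j))"]
          borel_measurable_times gain_measurable m \<theta>m AE_I2)
    have "sq_integrable \<mu> (\<lambda>x. gain \<theta> i x * w i x)"
      by (rule sq_integrable_bounded_mult[OF w gain_measurable gain_bounded[OF \<theta>]]) (auto intro: \<theta>m)
    then show "sq_integrable \<mu> (\<lambda>x. w i x * gain \<theta> i x)" by (simp add: mult.commute)
  qed
  then show "sq_integrable \<mu> (exchange \<theta> w i)" .
  have bound: "(\<integral>x. exchange \<theta> w i x * w i x \<partial>\<mu>) \<le> \<kappa> * (\<Sum>j\<in>UNIV. I j) * I i + gain_rate * N i" for i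
  proof -
    have "(\<integral>x. exchange \<theta> w i x * w i x \<partial>\<mu>)
        \<le> (\<integral>x. \<kappa> * (\<Sum>j\<in>UNIV. I j) * \<bar>w i x\<bar> + gain_rate * (w i x)\<^sup>2 \<partial>\<mu>)"
    proof (rule integral_mono)
      show "integrable \<mu> (\<lambda>x. exchange \<theta> w i x * w i x)" by (rule sq_integrable_mult[OF Esq w])
      show "integrable \<mu> (\<lambda>x. \<kappa> * (\<Sum>j\<in>UNIV. I j) * \<bar>w i x\<bar> + gain_rate * (w i x)\<^sup>2)"
        using int int2 by auto
      fix x assume x: "x \<in> space \<mu>"
      have *: "\<bar>\<theta> i x * gain w i x\<bar> \<le> 1 * (\<kappa> * (\<Sum>j\<in>UNIV. I j))"
        unfolding abs_mult I_def
        by (intro mult_mono bounded_familyD(2)[OF \<theta> x] gain_bound int x) auto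
      have "\<theta> i x * gain w i x * w i x \<le> \<bar>\<theta> i x * gain w i x\<bar> * \<bar>w i x\<bar>"
        unfolding abs_mult[symmetric] by (rule abs_ge_self)
      also have "\<dots> \<le> 1 * (\<kappa> * (\<Sum>j\<in>UNIV. I j)) * \<bar>w i x\<bar>"
        by (rule mult_right_mono[OF * abs_ge_zero])
      finally have "\<theta> i x * gain w i x * w i x \<le> \<kappa> * (\<Sum>j\<in>UNIV. I j) * \<bar>w i x\<bar>"
        by (simp only: mult_1)
      moreover have "- gain \<theta> i x * (w i x)\<^sup>2 \<le> gain_rate * (w i x)\<^sup>2"
        using gain_bounded[OF \<theta> x, of i] by (intro mult_right_mono) auto
      ultimately show "exchange \<theta> w i x * w i x
          \<le> \<kappa> * (\<Sum>j\<in>UNIV. I j) * \<bar>w i x\<bar> + gain_rate * (w i x)\<^sup>2"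
        unfolding exchange_def by (simp add: algebra_simps power2_eq_square)
    qed
    then show ?thesis using int int2 by (simp add: I_def N_def)
  qed
  have CS: "(\<Sum>i\<in>UNIV. I i)\<^sup>2 \<le> real CARD('i) * V * (\<Sum>i\<in>UNIV. N i)"
  proof -
    have "(\<Sum>i\<in>UNIV. 1 * I i)\<^sup>2 \<le> (\<Sum>i\<in>(UNIV :: 'i set). 1\<^sup>2) * (\<Sum>i\<in>UNIV. (I i)\<^sup>2)"
      by (rule Cauchy_Schwarz_ineq_sum)
    also have "\<dots> \<le> real CARD('i) * (\<Sum>i\<in>UNIV. V * N i)"
      unfolding I_def N_def V_def
      by (simp, intro mult_left_mono sum_mono square_integral_le w)
    finally show ?thesis by (simp add: sum_distrib_left[symmetric] mult.assoc)
  qed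
  have "(\<Sum>i\<in>UNIV. \<integral>x. exchange \<theta> w i x * w i x \<partial>\<mu>)
      \<le> (\<Sum>i\<in>UNIV. \<kappa> * (\<Sum>j\<in>UNIV. I j) * I i + gain_rate * N i)"
    by (intro sum_mono bound)
  also have "\<dots> = \<kappa> * (\<Sum>i\<in>UNIV. I i)\<^sup>2 + gain_rate * (\<Sum>i\<in>UNIV. N i)"
    by (simp add: sum.distrib sum_distrib_left[symmetric] power2_eq_square mult.assoc)
  also have "\<dots> \<le> 2 * gain_rate * (\<Sum>i\<in>UNIV. N i)"
    using mult_left_mono[OF CS \<kappa>_nonneg] by (simp add: gain_rate_def V_def mult_ac)
  finally show "(\<Sum>i\<in>UNIV. \<integral>x. exchange \<theta> w i x * w i x \<partial>\<mu>)
           \<le> 2 * gain_rate * (\<Sum>i\<in>UNIV. \<integral>x. (w i x)\<^sup>2 \<partial>\<mu>)"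
    by (simp add: N_def)
qed

text \<open>
  Gronwall's inequality for the sum of the squared norms of all phases.
\<close>

lemma exchange_flow_unique:
  assumes \<theta>: "bounded_family 1 \<theta>" and w: "\<And>i s. s > 0 \<Longrightarrow> sq_integrable \<mu> (w i s)"
    and init: "\<And>i. ((\<lambda>s. \<integral>x. (w i s x)\<^sup>2 \<partial>\<mu>) \<longlongrightarrow> 0) (at_right 0)"
    and deriv: "\<And>i t. t > 0 \<Longrightarrow>
      ((\<lambda>s. \<integral>x. ((w i s x - w i t x) / (s - t) - exchange \<theta> (\<lambda>j. w j t) i x)\<^sup>2 \<partial>\<mu>) \<longlongrightarrow> 0) (at t)"
    and t: "t > 0"
  shows "AE x in \<mu>. w i t x = 0"
proof -
  define E where "E = (\<lambda>s. \<Sum>i\<in>UNIV. \<integral>x. (w i s x)\<^sup>2 \<partial>\<mu>)"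
  define E' where "E' = (\<lambda>s. \<Sum>i\<in>UNIV. 2 * (\<integral>x. exchange \<theta> (\<lambda>j. w j s) i x * w i s x \<partial>\<mu>))"
  have "E t = 0"
  proof (rule Gronwall_zero[where C = "4 * gain_rate" and E = E and E' = E' and t = t])
    fix s :: real assume s: "s > 0"
    show "(E has_real_derivative E' s) (at s)"
      unfolding E_def E'_def
    proof (rule DERIV_sum)
      fix i
      show "((\<lambda>s. \<integral>x. (w i s x)\<^sup>2 \<partial>\<mu>) has_real_derivative
          2 * (\<integral>x. exchange \<theta> (\<lambda>j. w j s) i x * w i s x \<partial>\<mu>)) (at s)"
        using s by (intro sq_norm_has_derivative w energy_estimate(1)[OF \<theta>] deriv)
    qed
    show "E' s \<le> 4 * gain_rate * E s"
      using energy_estimate(2)[OF \<theta>, of "\<lambda>i. w i s", OF w[OF s]]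
      by (simp add: E_def E'_def sum_distrib_left[symmetric])
    show "0 \<le> E s" by (simp add: E_def sum_nonneg)
  next
    have "(E \<longlongrightarrow> (\<Sum>i\<in>(UNIV :: 'i set). 0)) (at_right 0)"
      unfolding E_def by (intro tendsto_sum init)
    then show "(E \<longlongrightarrow> 0) (at_right 0)" by simp
  qed (rule t)
  then have "(\<integral>x. (w i t x)\<^sup>2 \<partial>\<mu>) = 0"
    by (simp add: E_def sum_nonneg_eq_0_iff)
  then have "AE x in \<mu>. (w i t x)\<^sup>2 = 0"
    using integral_nonneg_eq_0_iff_AE[OF sq_integrable_square[OF w[OF t, of i]]] by simp
  then show ?thesis by simp
qed

section \<open>Solution of the exchange equation as a power series in time\<close>

text \<open>
  The time derivatives at \<open>0\<close> of the solution that starts from \<open>0\<close>. The sign \<open>(- 1) ^ k\<close> is the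
  \<open>k\<close>-th derivative at \<open>0\<close> of the factor \<open>exp (- t)\<close> of the source \<open>S\<close>.
\<close>

primrec coef :: "('i \<Rightarrow> 'a \<Rightarrow> real) \<Rightarrow> ('i \<Rightarrow> 'a \<Rightarrow> real) \<Rightarrow> nat \<Rightarrow> 'i \<Rightarrow> 'a \<Rightarrow> real" where
  "coef \<theta> S 0 = (\<lambda>i x. 0)"
| "coef \<theta> S (Suc k) = (\<lambda>i x. exchange \<theta> (coef \<theta> S k) i x + (- 1) ^ k * (S i x * \<theta> i x))"

text \<open>
  At least \<open>1\<close>, and large enough that the operator bound \<open>2 * gain_rate\<close> and the size \<open>\<sigma>\<close> of the
  source are absorbed in a single factor per step of the recursion.
\<close>

definition growth :: "real \<Rightarrow> real" where
  "growth \<sigma> = 2 * gain_rate + \<sigma> + 1"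

text \<open>
  The bound does not involve \<open>\<theta>\<close>, so it is uniform along a sequence of volume fractions. The
  factor \<open>1\<close> is the prefactor \<open>B\<close> of the lemmas on \<open>egf\<close>.
\<close>

lemma coef_bounded:
  assumes \<theta>: "bounded_family 1 \<theta>" and S: "bounded_family \<sigma> S" and \<sigma>: "0 \<le> \<sigma>"
  shows "bounded_family (1 * growth \<sigma> ^ k) (coef \<theta> S k)"
proof (induction k)
  case 0
  then show ?case by (simp add: bounded_family_def)
next
  case (Suc k)
  have g: "1 \<le> growth \<sigma>" using gain_rate_nonneg \<sigma> by (simp add: growth_def)
  then have g1: "1 \<le> growth \<sigma> ^ k" by simp
  have IH: "bounded_family (growth \<sigma> ^ k) (coef \<theta> S k)" using Suc by simp
  note D = bounded_familyD[OF \<theta>] bounded_familyD[OF S] bounded_familyD[OF IH]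
  have "\<bar>coef \<theta> S (Suc k) i x\<bar> \<le> growth \<sigma> ^ Suc k" if x: "x \<in> space \<mu>" for i x
  proof -
    have "\<bar>S i x\<bar> * \<bar>\<theta> i x\<bar> \<le> \<sigma> * 1" by (intro mult_mono D \<sigma> x) auto
    then have 1: "\<bar>(- 1) ^ k * (S i x * \<theta> i x)\<bar> \<le> \<sigma>" by (simp add: abs_mult power_abs)
    have "\<sigma> * 1 \<le> \<sigma> * growth \<sigma> ^ k" by (intro mult_left_mono g1 \<sigma>)
    then have "2 * gain_rate * growth \<sigma> ^ k + \<sigma> \<le> growth \<sigma> ^ Suc k"
      using g1 by (simp add: growth_def algebra_simps)
    then show ?thesis
      using exchange_bounded[OF \<theta> IH x, of i] 1
      by (simp only: coef.simps)
  qed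
  moreover have "coef \<theta> S (Suc k) i \<in> borel_measurable \<mu>" for i
    by (simp only: coef.simps)
       (intro borel_measurable_add borel_measurable_times borel_measurable_const exchange_measurable D)
  ultimately show ?case by (simp add: bounded_family_def del: coef.simps power_Suc)
qed

definition flow :: "('i \<Rightarrow> 'a \<Rightarrow> real) \<Rightarrow> ('i \<Rightarrow> 'a \<Rightarrow> real) \<Rightarrow> 'i \<Rightarrow> real \<Rightarrow> 'a \<Rightarrow> real" where
  "flow \<theta> S i t x = egf (\<lambda>k. coef \<theta> S k i x) t"

lemma coef_measurable:
  assumes "bounded_family 1 \<theta>" and "bounded_family \<sigma> S" and "0 \<le> \<sigma>"
  shows "coef \<theta> S k i \<in> borel_measurable \<mu>"
  by (rule bounded_familyD(1)[OF coef_bounded[OF assms]])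

lemma coef_bound:
  assumes "bounded_family 1 \<theta>" and "bounded_family \<sigma> S" and "0 \<le> \<sigma>" and "x \<in> space \<mu>"
  shows "\<bar>coef \<theta> S k i x\<bar> \<le> 1 * growth \<sigma> ^ k"
  by (rule bounded_familyD(2)[OF coef_bounded[OF assms(1-3)] assms(4)])

lemma flow_measurable:
  assumes "bounded_family 1 \<theta>" and "bounded_family \<sigma> S" and "0 \<le> \<sigma>"
  shows "flow \<theta> S i t \<in> borel_measurable \<mu>"
proof -
  note [measurable] = coef_measurable[OF assms]
  show ?thesis unfolding flow_def[abs_def] egf_def by measurable
qed

lemma flow_bound:
  assumes "bounded_family 1 \<theta>" and "bounded_family \<sigma> S" and "0 \<le> \<sigma>" and "x \<in> space \<mu>" and "\<bar>t\<bar> \<le> r"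
  shows "\<bar>flow \<theta> S i t x\<bar> \<le> exp (growth \<sigma> * r)"
  using egf_bound[OF coef_bound[OF assms(1-4)] assms(5)] by (simp add: flow_def)

lemma gain_flow:
  assumes \<theta>: "bounded_family 1 \<theta>" and S: "bounded_family \<sigma> S" and \<sigma>: "0 \<le> \<sigma>" and x: "x \<in> space \<mu>"
  shows "(\<lambda>k. gain (coef \<theta> S k) i x * t ^ k / fact k) sums gain (\<lambda>j. flow \<theta> S j t) i x"
proof -
  have Kint: "integrable \<mu> (K i j x)" for j
    using K_mult_integrable[of "\<lambda>_. 1", OF _ x] by simp
  have "(\<lambda>k. (\<integral>y. K i j x y * (coef \<theta> S k j y * t ^ k / fact k) \<partial>\<mu>)) sums
      (\<integral>y. K i j x y * flow \<theta> S j t y \<partial>\<mu>)" for j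
    unfolding flow_def
    by (rule egf_integral_sums[where \<tau> = "\<lambda>_. t" and r = "\<bar>t\<bar>", OF Kint coef_measurable[OF \<theta> S \<sigma>] _
          coef_bound[OF \<theta> S \<sigma>]]) auto
  then have "(\<lambda>k. \<Sum>j\<in>UNIV. \<integral>y. K i j x y * (coef \<theta> S k j y * t ^ k / fact k) \<partial>\<mu>) sums
      gain (\<lambda>j. flow \<theta> S j t) i x"
    unfolding gain_def by (intro sums_sum)
  moreover have "(\<Sum>j\<in>UNIV. \<integral>y. K i j x y * (coef \<theta> S k j y * t ^ k / fact k) \<partial>\<mu>)
      = gain (coef \<theta> S k) i x * t ^ k / fact k" for k
  proof -
    have "(\<integral>y. K i j x y * (coef \<theta> S k j y * t ^ k / fact k) \<partial>\<mu>)
        = (\<integral>y. K i j x y * coef \<theta> S k j y \<partial>\<mu>) * (t ^ k / fact k)" for j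
      using integral_mult_left_zero[of \<mu> "\<lambda>y. K i j x y * coef \<theta> S k j y" "t ^ k / fact k"]
      by (simp add: mult.assoc)
    then show ?thesis by (simp add: gain_def sum_distrib_right sum_divide_distrib)
  qed
  ultimately show ?thesis by simp
qed

text \<open>
  The recursion of the coefficients, summed: the left-hand side is the time derivative of
  \<open>flow\<close>.
\<close>

lemma egf_coef_Suc:
  assumes \<theta>: "bounded_family 1 \<theta>" and S: "bounded_family \<sigma> S" and \<sigma>: "0 \<le> \<sigma>" and x: "x \<in> space \<mu>"
  shows "egf (\<lambda>k. coef \<theta> S (Suc k) i x) t
           = exchange \<theta> (\<lambda>j. flow \<theta> S j t) i x + exp (- t) * (S i x * \<theta> i x)"
proof -
  have "(\<lambda>k. \<theta> i x * (gain (coef \<theta> S k) i x * t ^ k / fact k)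
            - coef \<theta> S k i x * t ^ k / fact k * gain \<theta> i x
            + (- 1) ^ k * (S i x * \<theta> i x) * t ^ k / fact k)
      sums (\<theta> i x * gain (\<lambda>j. flow \<theta> S j t) i x - flow \<theta> S i t x * gain \<theta> i x
            + egf (\<lambda>k. (- 1) ^ k * (S i x * \<theta> i x)) t)"
    unfolding flow_def[of _ _ i t x]
    by (intro sums_add sums_diff sums_mult sums_mult2 gain_flow[OF \<theta> S \<sigma> x]
        egf_sums[OF coef_bound[OF \<theta> S \<sigma> x]] egf_sums[where B = "\<bar>S i x * \<theta> i x\<bar>" and D = 1])
       (simp add: abs_mult power_abs)
  moreover have "\<theta> i x * (gain (coef \<theta> S k) i x * t ^ k / fact k)
            - coef \<theta> S k i x * t ^ k / fact k * gain \<theta> i x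
            + (- 1) ^ k * (S i x * \<theta> i x) * t ^ k / fact k
      = coef \<theta> S (Suc k) i x * t ^ k / fact k" for k
    by (simp add: exchange_def field_simps)
  ultimately have "(\<lambda>k. coef \<theta> S (Suc k) i x * t ^ k / fact k)
      sums (exchange \<theta> (\<lambda>j. flow \<theta> S j t) i x + exp (- t) * (S i x * \<theta> i x))"
    by (simp only: egf_exp_minus exchange_def[of \<theta> "\<lambda>j. flow \<theta> S j t"])
  then show ?thesis unfolding egf_def by (rule sums_unique[symmetric])
qed

end

section \<open>Weak-star continuity in the volume fractions\<close>

definition weak_star :: "'b measure \<Rightarrow> (nat \<Rightarrow> 'b \<Rightarrow> real) \<Rightarrow> ('b \<Rightarrow> real) \<Rightarrow> bool" where
  "weak_star \<nu> f g \<longleftrightarrow>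
     (\<forall>\<phi>. integrable \<nu> \<phi> \<longrightarrow> (\<lambda>n. \<integral>x. f n x * \<phi> x \<partial>\<nu>) \<longlonglongrightarrow> (\<integral>x. g x * \<phi> x \<partial>\<nu>))"

lemma weak_starD:
  "weak_star \<nu> f g \<Longrightarrow> integrable \<nu> \<phi> \<Longrightarrow> (\<lambda>n. \<integral>x. f n x * \<phi> x \<partial>\<nu>) \<longlonglongrightarrow> (\<integral>x. g x * \<phi> x \<partial>\<nu>)"
  by (simp add: weak_star_def)

lemma bounded_mult_integrable:
  fixes f \<phi> :: "'b \<Rightarrow> real"
  assumes "f \<in> borel_measurable \<nu>" and "\<And>x. x \<in> space \<nu> \<Longrightarrow> \<bar>f x\<bar> \<le> c" and "integrable \<nu> \<phi>"
  shows "integrable \<nu> (\<lambda>x. f x * \<phi> x)"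
proof (rule Bochner_Integration.integrable_bound)
  show "integrable \<nu> (\<lambda>x. c * \<phi> x)" using assms by simp
  show "(\<lambda>x. f x * \<phi> x) \<in> borel_measurable \<nu>" using assms by auto
  have "\<bar>f x\<bar> * \<bar>\<phi> x\<bar> \<le> \<bar>c\<bar> * \<bar>\<phi> x\<bar>" if "x \<in> space \<nu>" for x
    using assms(2)[OF that] by (intro mult_right_mono) auto
  then show "AE x in \<nu>. norm (f x * \<phi> x) \<le> norm (c * \<phi> x)"
    by (intro AE_I2) (simp only: real_norm_def abs_mult)
qed

text \<open>
  Split \<open>f\<^sub>n h\<^sub>n - g H = f\<^sub>n (h\<^sub>n - H) + (f\<^sub>n - g) H\<close>. The first part tends to \<open>0\<close> by dominated
  convergence; in the second, \<open>H \<phi>\<close> is an admissible test function.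
\<close>

lemma weak_star_mult_pointwise:
  fixes \<nu> :: "'b measure"
  assumes weak: "weak_star \<nu> f g"
    and f: "\<And>n. f n \<in> borel_measurable \<nu>" "\<And>n x. x \<in> space \<nu> \<Longrightarrow> \<bar>f n x\<bar> \<le> c"
    and g: "g \<in> borel_measurable \<nu>" "\<And>x. x \<in> space \<nu> \<Longrightarrow> \<bar>g x\<bar> \<le> c"
    and h: "\<And>n. h n \<in> borel_measurable \<nu>" "\<And>n x. x \<in> space \<nu> \<Longrightarrow> \<bar>h n x\<bar> \<le> d"
    and H: "H \<in> borel_measurable \<nu>" "\<And>x. x \<in> space \<nu> \<Longrightarrow> \<bar>H x\<bar> \<le> d"
    and lim: "\<And>x. x \<in> space \<nu> \<Longrightarrow> (\<lambda>n. h n x) \<longlonglongrightarrow> H x"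
  shows "weak_star \<nu> (\<lambda>n x. f n x * h n x) (\<lambda>x. g x * H x)"
  unfolding weak_star_def
proof (intro allI impI)
  fix \<phi> :: "'b \<Rightarrow> real" assume \<phi>: "integrable \<nu> \<phi>"
  have [measurable]: "\<phi> \<in> borel_measurable \<nu>" using \<phi> by auto
  note [measurable] = f(1) g(1) h(1) H(1)
  have H\<phi>: "integrable \<nu> (\<lambda>x. H x * \<phi> x)" by (rule bounded_mult_integrable[OF H \<phi>])
  have h\<phi>: "integrable \<nu> (\<lambda>x. h n x * \<phi> x)" for n by (rule bounded_mult_integrable[OF h \<phi>])
  have fH\<phi>: "integrable \<nu> (\<lambda>x. f n x * (H x * \<phi> x))" for n
    by (rule bounded_mult_integrable[OF f H\<phi>])
  have fh\<phi>: "integrable \<nu> (\<lambda>x. f n x * (h n x * \<phi> x))" for n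
    by (rule bounded_mult_integrable[OF f h\<phi>])
  have "(\<lambda>n. \<integral>x. f n x * (h n x * \<phi> x) - f n x * (H x * \<phi> x) \<partial>\<nu>) \<longlonglongrightarrow> (\<integral>x. 0 \<partial>\<nu>)"
  proof (rule integral_dominated_convergence[where w = "\<lambda>x. c * (2 * d) * \<bar>\<phi> x\<bar>"])
    have eq: "f n x * (h n x * \<phi> x) - f n x * (H x * \<phi> x) = f n x * (h n x - H x) * \<phi> x" for n x
      by (simp add: algebra_simps)
    show "AE x in \<nu>. (\<lambda>n. f n x * (h n x * \<phi> x) - f n x * (H x * \<phi> x)) \<longlonglongrightarrow> 0"
    proof (rule AE_I2)
      fix x assume x: "x \<in> space \<nu>"
      show "(\<lambda>n. f n x * (h n x * \<phi> x) - f n x * (H x * \<phi> x)) \<longlonglongrightarrow> 0"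
      proof (rule Lim_null_comparison)
        show "\<forall>\<^sub>F n in sequentially. norm (f n x * (h n x * \<phi> x) - f n x * (H x * \<phi> x))
            \<le> c * \<bar>h n x - H x\<bar> * \<bar>\<phi> x\<bar>"
          unfolding eq real_norm_def abs_mult
          by (intro always_eventually allI mult_right_mono f(2) x) auto
        have "(\<lambda>n. c * \<bar>h n x - H x\<bar> * \<bar>\<phi> x\<bar>) \<longlonglongrightarrow> c * \<bar>H x - H x\<bar> * \<bar>\<phi> x\<bar>"
          by (intro tendsto_intros lim x)
        then show "(\<lambda>n. c * \<bar>h n x - H x\<bar> * \<bar>\<phi> x\<bar>) \<longlonglongrightarrow> 0" by simp
      qed
    qed
    show "AE x in \<nu>. norm (f n x * (h n x * \<phi> x) - f n x * (H x * \<phi> x)) \<le> c * (2 * d) * \<bar>\<phi> x\<bar>" for n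
    proof (rule AE_I2)
      fix x assume x: "x \<in> space \<nu>"
      have "\<bar>h n x - H x\<bar> \<le> 2 * d" using h(2)[OF x, of n] H(2)[OF x] by linarith
      moreover have "0 \<le> c" using g(2)[OF x] by linarith
      ultimately show "norm (f n x * (h n x * \<phi> x) - f n x * (H x * \<phi> x)) \<le> c * (2 * d) * \<bar>\<phi> x\<bar>"
        unfolding eq real_norm_def abs_mult by (intro mult_right_mono mult_mono f(2) x) auto
    qed
    show "integrable \<nu> (\<lambda>x. c * (2 * d) * \<bar>\<phi> x\<bar>)" using \<phi> by auto
  qed simp_all
  then have "(\<lambda>n. (\<integral>x. f n x * (h n x * \<phi> x) \<partial>\<nu>) - (\<integral>x. f n x * (H x * \<phi> x) \<partial>\<nu>)) \<longlonglongrightarrow> 0"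
    by (simp only: Bochner_Integration.integral_diff[OF fh\<phi> fH\<phi>] Bochner_Integration.integral_zero)
  from tendsto_add[OF this weak_starD[OF weak H\<phi>]]
  show "(\<lambda>n. \<integral>x. f n x * h n x * \<phi> x \<partial>\<nu>) \<longlonglongrightarrow> (\<integral>x. g x * H x * \<phi> x \<partial>\<nu>)"
    by (simp add: mult.assoc)
qed

lemma weak_star_add:
  fixes \<nu> :: "'b measure"
  assumes "weak_star \<nu> f g" and "weak_star \<nu> f' g'"
    and "\<And>n. f n \<in> borel_measurable \<nu>" and "\<And>n x. x \<in> space \<nu> \<Longrightarrow> \<bar>f n x\<bar> \<le> c"
    and "\<And>n. f' n \<in> borel_measurable \<nu>" and "\<And>n x. x \<in> space \<nu> \<Longrightarrow> \<bar>f' n x\<bar> \<le> c"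
    and "g \<in> borel_measurable \<nu>" and "\<And>x. x \<in> space \<nu> \<Longrightarrow> \<bar>g x\<bar> \<le> c"
    and "g' \<in> borel_measurable \<nu>" and "\<And>x. x \<in> space \<nu> \<Longrightarrow> \<bar>g' x\<bar> \<le> c"
  shows "weak_star \<nu> (\<lambda>n x. f n x + u * f' n x) (\<lambda>x. g x + u * g' x)"
  unfolding weak_star_def
proof (intro allI impI)
  fix \<phi> :: "'b \<Rightarrow> real" assume \<phi>: "integrable \<nu> \<phi>"
  note i = bounded_mult_integrable[OF assms(3,4) \<phi>] bounded_mult_integrable[OF assms(5,6) \<phi>]
    bounded_mult_integrable[OF assms(7,8) \<phi>] bounded_mult_integrable[OF assms(9,10) \<phi>]
  have "(\<lambda>n. (\<integral>x. f n x * \<phi> x \<partial>\<nu>) + u * (\<integral>x. f' n x * \<phi> x \<partial>\<nu>))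
      \<longlonglongrightarrow> (\<integral>x. g x * \<phi> x \<partial>\<nu>) + u * (\<integral>x. g' x * \<phi> x \<partial>\<nu>)"
    by (intro tendsto_intros weak_starD[OF assms(1) \<phi>] weak_starD[OF assms(2) \<phi>])
  then show "(\<lambda>n. \<integral>x. (f n x + u * f' n x) * \<phi> x \<partial>\<nu>) \<longlonglongrightarrow> (\<integral>x. (g x + u * g' x) * \<phi> x \<partial>\<nu>)"
    using i by (simp add: distrib_right mult.assoc)
qed

context mixture
begin

text \<open>
  For a fixed \<open>x\<close> the kernel is itself an integrable test function, which is how weak convergence
  is upgraded to pointwise convergence.
\<close>

lemma gain_tendsto:
  assumes weak: "\<And>j. weak_star \<mu> (\<lambda>n. f n j) (g j)" and x: "x \<in> space \<mu>"
  shows "(\<lambda>n. gain (f n) i x) \<longlonglongrightarrow> gain g i x"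
  unfolding gain_def
proof (rule tendsto_sum)
  fix j
  have "integrable \<mu> (K i j x)" using K_mult_integrable[of "\<lambda>_. 1", OF _ x] by simp
  from weak_starD[OF weak this]
  show "(\<lambda>n. \<integral>y. K i j x y * f n j y \<partial>\<mu>) \<longlonglongrightarrow> (\<integral>y. K i j x y * g j y \<partial>\<mu>)"
    by (simp add: mult.commute)
qed

lemma bounded_family_gain:
  "bounded_family c f \<Longrightarrow> bounded_family (gain_rate * c) (gain f)"
  unfolding bounded_family_def[of "gain_rate * c"]
  by (auto intro: gain_measurable gain_bounded bounded_familyD(1))

lemma bounded_family_mult:
  assumes "bounded_family c f" and "bounded_family d g"
  shows "bounded_family (c * d) (\<lambda>i x. f i x * g i x)"
  unfolding bounded_family_def
proof (intro allI conjI ballI)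
  fix i x assume x: "x \<in> space \<mu>"
  have "0 \<le> c" using bounded_familyD(2)[OF assms(1) x, of i] by linarith
  then show "\<bar>f i x * g i x\<bar> \<le> c * d"
    unfolding abs_mult by (intro mult_mono bounded_familyD(2)[OF assms(1) x] bounded_familyD(2)[OF assms(2) x]) auto
qed (intro borel_measurable_times bounded_familyD(1)[OF assms(1)] bounded_familyD(1)[OF assms(2)])

lemma weak_star_family_mult:
  assumes "weak_star \<mu> (\<lambda>n. f n i) (g i)"
    and "\<And>n. bounded_family c (f n)" and "bounded_family c g"
    and "\<And>n. bounded_family d (h n)" and "bounded_family d H"
    and "\<And>x. x \<in> space \<mu> \<Longrightarrow> (\<lambda>n. h n i x) \<longlonglongrightarrow> H i x"
  shows "weak_star \<mu> (\<lambda>n x. f n i x * h n i x) (\<lambda>x. g i x * H i x)"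
  by (rule weak_star_mult_pointwise[OF assms(1) bounded_familyD[OF assms(2)] bounded_familyD[OF assms(3)]
        bounded_familyD[OF assms(4)] bounded_familyD[OF assms(5)] assms(6)])

lemma weak_star_family_add:
  assumes "weak_star \<mu> (\<lambda>n. f n i) (g i)" and "weak_star \<mu> (\<lambda>n. f' n i) (g' i)"
    and "\<And>n. bounded_family c (f n)" and "bounded_family c g"
    and "\<And>n. bounded_family d (f' n)" and "bounded_family d g'"
  shows "weak_star \<mu> (\<lambda>n x. f n i x + u * f' n i x) (\<lambda>x. g i x + u * g' i x)"
  by (rule weak_star_add[OF assms(1,2), where c = "max c d"])
     (use assms(3-6) in \<open>auto simp: bounded_family_def le_max_iff_disj\<close>)

text \<open>
  Both products in \<open>exchange\<close> pair a weak-star convergent factor with a gain, which converges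
  pointwise and boundedly; induction on \<open>k\<close> does the rest.
\<close>

lemma coef_weak_star:
  assumes \<theta>n: "\<And>n. bounded_family 1 (\<theta>n n)" and \<theta>: "bounded_family 1 \<theta>"
    and S: "bounded_family \<sigma> S" and \<sigma>: "0 \<le> \<sigma>"
    and weak: "\<And>i. weak_star \<mu> (\<lambda>n. \<theta>n n i) (\<theta> i)"
  shows "weak_star \<mu> (\<lambda>n. coef (\<theta>n n) S k i) (coef \<theta> S k i)"
proof (induction k arbitrary: i)
  case 0
  then show ?case by (simp add: weak_star_def)
next
  case (Suc k)
  let ?D = "1 * growth \<sigma> ^ k"
  note cn = coef_bounded[OF \<theta>n S \<sigma>, where k = k] and c = coef_bounded[OF \<theta> S \<sigma>, of k]
  note b = bounded_family_mult[OF \<theta>n bounded_family_gain[OF cn]]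
    bounded_family_mult[OF \<theta> bounded_family_gain[OF c]]
    bounded_family_mult[OF cn bounded_family_gain[OF \<theta>n]]
    bounded_family_mult[OF c bounded_family_gain[OF \<theta>]]
    bounded_family_mult[OF \<theta>n S] bounded_family_mult[OF \<theta> S]
  have "weak_star \<mu> (\<lambda>n x. \<theta>n n i x * gain (coef (\<theta>n n) S k) i x) (\<lambda>x. \<theta> i x * gain (coef \<theta> S k) i x)"
    by (rule weak_star_family_mult[where f = \<theta>n and g = \<theta> and h = "\<lambda>n. gain (coef (\<theta>n n) S k)" and H = "gain (coef \<theta> S k)",
        OF weak \<theta>n \<theta> bounded_family_gain[OF cn] bounded_family_gain[OF c] gain_tendsto[OF Suc]])
  moreover have "weak_star \<mu> (\<lambda>n x. coef (\<theta>n n) S k i x * gain (\<theta>n n) i x)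
      (\<lambda>x. coef \<theta> S k i x * gain \<theta> i x)"
    by (rule weak_star_family_mult[where f = "\<lambda>n. coef (\<theta>n n) S k" and g = "coef \<theta> S k" and h = "\<lambda>n. gain (\<theta>n n)" and H = "gain \<theta>",
        OF Suc cn c bounded_family_gain[OF \<theta>n] bounded_family_gain[OF \<theta>] gain_tendsto[OF weak]])
  ultimately have e: "weak_star \<mu>
      (\<lambda>n x. \<theta>n n i x * gain (coef (\<theta>n n) S k) i x + (- 1) * (coef (\<theta>n n) S k i x * gain (\<theta>n n) i x))
      (\<lambda>x. \<theta> i x * gain (coef \<theta> S k) i x + (- 1) * (coef \<theta> S k i x * gain \<theta> i x))"
    by (rule weak_star_family_add[where f = "\<lambda>n i x. \<theta>n n i x * gain (coef (\<theta>n n) S k) i x"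
        and f' = "\<lambda>n i x. coef (\<theta>n n) S k i x * gain (\<theta>n n) i x"
        and g = "\<lambda>i x. \<theta> i x * gain (coef \<theta> S k) i x"
        and g' = "\<lambda>i x. coef \<theta> S k i x * gain \<theta> i x", OF _ _ b(1-4)])
  then have e': "weak_star \<mu> (\<lambda>n. exchange (\<theta>n n) (coef (\<theta>n n) S k) i) (exchange \<theta> (coef \<theta> S k) i)"
    by (simp add: exchange_def[abs_def])
  have eb: "bounded_family (2 * gain_rate * ?D) (exchange \<theta>' (coef \<theta>' S k))" if "bounded_family 1 \<theta>'" for \<theta>'
    using coef_bounded[OF that S \<sigma>, of k] that unfolding bounded_family_def[of "2 * gain_rate * ?D"]
    by (auto intro!: exchange_measurable exchange_bounded intro: bounded_familyD(1))
  have s: "weak_star \<mu> (\<lambda>n x. \<theta>n n i x * S i x) (\<lambda>x. \<theta> i x * S i x)"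
    by (rule weak_star_family_mult[where f = \<theta>n and g = \<theta> and h = "\<lambda>n. S" and H = S,
        OF weak \<theta>n \<theta> S S tendsto_const])
  have "weak_star \<mu>
      (\<lambda>n x. exchange (\<theta>n n) (coef (\<theta>n n) S k) i x + (- 1) ^ k * (\<theta>n n i x * S i x))
      (\<lambda>x. exchange \<theta> (coef \<theta> S k) i x + (- 1) ^ k * (\<theta> i x * S i x))"
    by (rule weak_star_family_add[where f = "\<lambda>n. exchange (\<theta>n n) (coef (\<theta>n n) S k)"
        and f' = "\<lambda>n i x. \<theta>n n i x * S i x" and g = "exchange \<theta> (coef \<theta> S k)"
        and g' = "\<lambda>i x. \<theta> i x * S i x", OF e' s eb[OF \<theta>n] eb[OF \<theta>] b(5,6)])
  then show ?case by (simp add: mult.commute)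
qed

text \<open>
  Each term of the series converges: by Fubini, integrating the test function against \<open>t\<^sup>k\<close> first
  leaves a test function of \<open>x\<close> alone for the coefficient. Tannery's theorem sums the limits.
\<close>

lemma flow_weak_convergence:
  fixes \<eta> :: "real measure"
  assumes \<theta>n: "\<And>n. bounded_family 1 (\<theta>n n)" and \<theta>: "bounded_family 1 \<theta>"
    and S: "bounded_family \<sigma> S" and \<sigma>: "0 \<le> \<sigma>"
    and weak: "\<And>i. weak_star \<mu> (\<lambda>n. \<theta>n n i) (\<theta> i)"
    and "sigma_finite_measure \<eta>" and id: "(\<lambda>t. t) \<in> borel_measurable \<eta>"
    and r: "\<And>t. t \<in> space \<eta> \<Longrightarrow> \<bar>t\<bar> \<le> r"
    and \<phi>: "integrable (\<eta> \<Otimes>\<^sub>M \<mu>) \<phi>"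
  shows "(\<lambda>n. \<integral>p. \<phi> p * flow (\<theta>n n) S i (fst p) (snd p) \<partial>(\<eta> \<Otimes>\<^sub>M \<mu>))
           \<longlonglongrightarrow> (\<integral>p. \<phi> p * flow \<theta> S i (fst p) (snd p) \<partial>(\<eta> \<Otimes>\<^sub>M \<mu>))"
proof -
  interpret \<eta>: sigma_finite_measure \<eta> by fact
  interpret pair_sigma_finite \<eta> \<mu> ..
  define trm where "trm = (\<lambda>\<theta> k. \<integral>p. \<phi> p * (coef \<theta> S k i (snd p) * fst p ^ k / fact k) \<partial>(\<eta> \<Otimes>\<^sub>M \<mu>))"
  have fstm: "fst \<in> borel_measurable (\<eta> \<Otimes>\<^sub>M \<mu>)"
    using measurable_compose[OF measurable_fst[of \<eta> \<mu>] id] by simp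
  have cm: "(\<lambda>p. coef \<theta> S k i (snd p)) \<in> borel_measurable (\<eta> \<Otimes>\<^sub>M \<mu>)" if "bounded_family 1 \<theta>" for \<theta> k
    by (rule measurable_compose[OF measurable_snd coef_measurable[OF that S \<sigma>]])
  have cb: "\<bar>coef \<theta> S k i (snd p)\<bar> \<le> 1 * growth \<sigma> ^ k"
    if "bounded_family 1 \<theta>" "p \<in> space (\<eta> \<Otimes>\<^sub>M \<mu>)" for \<theta> k p
    using coef_bound[OF that(1) S \<sigma>] that(2) by (auto simp: space_pair_measure)
  have rb: "\<bar>fst p\<bar> \<le> r" if "p \<in> space (\<eta> \<Otimes>\<^sub>M \<mu>)" for p
    using r that by (auto simp: space_pair_measure)
  have sums: "trm \<theta> sums (\<integral>p. \<phi> p * flow \<theta> S i (fst p) (snd p) \<partial>(\<eta> \<Otimes>\<^sub>M \<mu>))"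
    and bound: "\<And>k. \<bar>trm \<theta> k\<bar> \<le> (\<integral>p. \<bar>\<phi> p\<bar> \<partial>(\<eta> \<Otimes>\<^sub>M \<mu>)) * 1 * (growth \<sigma> * r) ^ k / fact k"
    if "bounded_family 1 \<theta>" for \<theta>
    unfolding trm_def flow_def
    using egf_integral_sums[OF \<phi> cm[OF that] fstm cb[OF that] rb]
      egf_integral_term_bound[OF \<phi> cm[OF that] fstm cb[OF that] rb] by blast+
  have Fubini: "trm \<theta> k = (\<integral>x. coef \<theta> S k i x * (\<integral>t. \<phi> (t, x) * (t ^ k / fact k) \<partial>\<eta>) \<partial>\<mu>)"
    and inner: "integrable \<mu> (\<lambda>x. \<integral>t. \<phi> (t, x) * (t ^ k / fact k) \<partial>\<eta>)"
    if "bounded_family 1 \<theta>" for \<theta> k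
  proof -
    have tk: "(\<lambda>p. fst p ^ k / fact k) \<in> borel_measurable (\<eta> \<Otimes>\<^sub>M \<mu>)" using fstm by simp
    have tb: "\<bar>fst p ^ k / fact k\<bar> \<le> r ^ k / fact k" if "p \<in> space (\<eta> \<Otimes>\<^sub>M \<mu>)" for p
      using rb[OF that] by (simp add: power_abs divide_right_mono power_mono)
    have i1: "integrable (\<eta> \<Otimes>\<^sub>M \<mu>) (\<lambda>p. (fst p ^ k / fact k) * \<phi> p)"
      by (rule bounded_mult_integrable[OF tk tb \<phi>])
    then have i1': "integrable (\<eta> \<Otimes>\<^sub>M \<mu>) (\<lambda>(t, x). \<phi> (t, x) * (t ^ k / fact k))"
      by (simp add: split_beta' mult.commute)
    show "integrable \<mu> (\<lambda>x. \<integral>t. \<phi> (t, x) * (t ^ k / fact k) \<partial>\<eta>)"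
      by (rule integrable_snd[OF i1'])
    have "integrable (\<eta> \<Otimes>\<^sub>M \<mu>) (\<lambda>p. coef \<theta> S k i (snd p) * ((fst p ^ k / fact k) * \<phi> p))"
      by (rule bounded_mult_integrable[OF cm[OF that] cb[OF that] i1])
    then have i2: "integrable (\<eta> \<Otimes>\<^sub>M \<mu>) (\<lambda>(t, x). coef \<theta> S k i x * (\<phi> (t, x) * (t ^ k / fact k)))"
      by (simp add: split_beta' mult_ac)
    have "trm \<theta> k = (\<integral>(t, x). coef \<theta> S k i x * (\<phi> (t, x) * (t ^ k / fact k)) \<partial>(\<eta> \<Otimes>\<^sub>M \<mu>))"
      unfolding trm_def by (simp add: split_beta' mult_ac)
    also have "\<dots> = (\<integral>x. (\<integral>t. coef \<theta> S k i x * (\<phi> (t, x) * (t ^ k / fact k)) \<partial>\<eta>) \<partial>\<mu>)"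
      by (rule integral_snd[OF i2, symmetric])
    finally show "trm \<theta> k = (\<integral>x. coef \<theta> S k i x * (\<integral>t. \<phi> (t, x) * (t ^ k / fact k) \<partial>\<eta>) \<partial>\<mu>)"
      by simp
  qed
  have "(\<lambda>n. \<Sum>k. trm (\<theta>n n) k) \<longlonglongrightarrow> (\<Sum>k. trm \<theta> k)"
  proof (rule tannerys_theorem[THEN conjunct2, THEN conjunct2])
    show "(\<lambda>n. trm (\<theta>n n) k) \<longlonglongrightarrow> trm \<theta> k" for k
      unfolding Fubini[OF \<theta>n] Fubini[OF \<theta>]
      by (rule weak_starD[OF coef_weak_star[OF \<theta>n \<theta> S \<sigma> weak] inner[OF \<theta>]])
    show "\<forall>\<^sub>F (k, n) in sequentially \<times>\<^sub>F sequentially. norm (trm (\<theta>n n) k)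
        \<le> (\<integral>p. \<bar>\<phi> p\<bar> \<partial>(\<eta> \<Otimes>\<^sub>M \<mu>)) * 1 * (growth \<sigma> * r) ^ k / fact k"
      using bound[OF \<theta>n] by (auto intro!: always_eventually)
    show "summable (\<lambda>k. (\<integral>p. \<bar>\<phi> p\<bar> \<partial>(\<eta> \<Otimes>\<^sub>M \<mu>)) * 1 * (growth \<sigma> * r) ^ k / fact k)"
      by (rule summable_geometric_over_fact)
  qed simp
  then show ?thesis by (simp only: sums_unique[OF sums[OF \<theta>n]] sums_unique[OF sums[OF \<theta>]])
qed

end

section \<open>Lebesgue measure on a domain and on space-time\<close>

abbreviation lborel_on :: "'b::euclidean_space set \<Rightarrow> 'b measure" where
  "lborel_on S \<equiv> restrict_space lborel S"

lemma set_borel_measurable_iff: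
  fixes f :: "'b::euclidean_space \<Rightarrow> real"
  assumes "S \<in> sets borel"
  shows "set_borel_measurable lborel S f \<longleftrightarrow> f \<in> borel_measurable (lborel_on S)"
  using assms by (simp add: set_borel_measurable_def borel_measurable_restrict_space_iff)

lemma set_integrable_iff:
  fixes f :: "'b::euclidean_space \<Rightarrow> real"
  assumes "S \<in> sets borel"
  shows "set_integrable lborel S f \<longleftrightarrow> integrable (lborel_on S) f"
  using assms by (simp add: set_integrable_def integrable_restrict_space)

lemma set_integral_eq:
  fixes f :: "'b::euclidean_space \<Rightarrow> real"
  assumes "S \<in> sets borel"
  shows "(LINT x:S|lborel. f x) = (\<integral>x. f x \<partial>lborel_on S)"
  using assms by (simp add: set_lebesgue_integral_def integral_restrict_space)

lemma L2_iff: "S \<in> sets borel \<Longrightarrow> f \<in> L2 S \<longleftrightarrow> sq_integrable (lborel_on S) f"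
  by (simp add: L2_def sq_integrable_def set_borel_measurable_iff set_integrable_iff)

lemma AE_lborel_on_iff:
  "S \<in> sets borel \<Longrightarrow> (AE x in lborel_on S. P x) \<longleftrightarrow> (AE x in lborel. x \<in> S \<longrightarrow> P x)"
  by (rule AE_restrict_space_iff) simp

lemma L2_tendsto_iff:
  assumes S: "S \<in> sets borel"
  shows "L2_tendsto S f g F \<longleftrightarrow> (\<forall>\<^sub>F i in F. sq_integrable (lborel_on S) (f i)) \<and>
    sq_integrable (lborel_on S) g \<and> ((\<lambda>i. \<integral>x. (f i x - g x)\<^sup>2 \<partial>lborel_on S) \<longlongrightarrow> 0) F"
proof -
  have "((\<lambda>i. sqrt (\<integral>x. (f i x - g x)\<^sup>2 \<partial>lborel_on S)) \<longlongrightarrow> 0) F \<longleftrightarrow>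
      ((\<lambda>i. \<integral>x. (f i x - g x)\<^sup>2 \<partial>lborel_on S) \<longlongrightarrow> 0) F"
  proof
    assume "((\<lambda>i. sqrt (\<integral>x. (f i x - g x)\<^sup>2 \<partial>lborel_on S)) \<longlongrightarrow> 0) F"
    from tendsto_power[OF this, of 2]
    show "((\<lambda>i. \<integral>x. (f i x - g x)\<^sup>2 \<partial>lborel_on S) \<longlongrightarrow> 0) F" by simp
  next
    assume "((\<lambda>i. \<integral>x. (f i x - g x)\<^sup>2 \<partial>lborel_on S) \<longlongrightarrow> 0) F"
    from tendsto_real_sqrt[OF this]
    show "((\<lambda>i. sqrt (\<integral>x. (f i x - g x)\<^sup>2 \<partial>lborel_on S)) \<longlongrightarrow> 0) F" by simp
  qed
  then show ?thesis
    by (simp add: L2_tendsto_def L2_norm_def L2_iff[OF S] set_integral_eq[OF S])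
qed

lemma L2_tendsto_diff:
  assumes S: "S \<in> sets borel" and f: "L2_tendsto S f g F" and f': "L2_tendsto S f' g' F"
  shows "L2_tendsto S (\<lambda>i x. f i x - f' i x) (\<lambda>x. g x - g' x) F"
proof -
  note f = f[unfolded L2_tendsto_iff[OF S]] and f' = f'[unfolded L2_tendsto_iff[OF S]]
  have lim: "((\<lambda>i. 2 * (\<integral>x. (f i x - g x)\<^sup>2 \<partial>lborel_on S) + 2 * (\<integral>x. (f' i x - g' x)\<^sup>2 \<partial>lborel_on S))
      \<longlongrightarrow> 2 * 0 + 2 * 0) F"
    using f f' by (intro tendsto_intros) auto
  have "((\<lambda>i. \<integral>x. ((f i x - f' i x) - (g x - g' x))\<^sup>2 \<partial>lborel_on S) \<longlongrightarrow> 0) F"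
  proof (rule Lim_null_comparison)
    show "\<forall>\<^sub>F i in F. norm (\<integral>x. ((f i x - f' i x) - (g x - g' x))\<^sup>2 \<partial>lborel_on S)
        \<le> 2 * (\<integral>x. (f i x - g x)\<^sup>2 \<partial>lborel_on S) + 2 * (\<integral>x. (f' i x - g' x)\<^sup>2 \<partial>lborel_on S)"
      using f[THEN conjunct1] f'[THEN conjunct1]
    proof eventually_elim
      case (elim i)
      have "(\<integral>x. ((f i x - f' i x) - (g x - g' x))\<^sup>2 \<partial>lborel_on S)
          = (\<integral>x. ((f i x - g x) + (- 1) * (f' i x - g' x))\<^sup>2 \<partial>lborel_on S)"
        by (intro Bochner_Integration.integral_cong refl arg_cong[where f = "\<lambda>x. x\<^sup>2"]) simp
      also have "\<dots> \<le> 2 * (\<integral>x. (f i x - g x)\<^sup>2 \<partial>lborel_on S)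
          + 2 * (\<integral>x. ((- 1) * (f' i x - g' x))\<^sup>2 \<partial>lborel_on S)"
        using elim f f' by (intro sq_norm_add_le sq_integrable_cmult sq_integrable_diff) auto
      finally show ?case by (simp add: power2_commute)
    qed
  qed (use lim in simp)
  moreover have "\<forall>\<^sub>F i in F. sq_integrable (lborel_on S) (\<lambda>x. f i x - f' i x)"
    using f[THEN conjunct1] f'[THEN conjunct1] by eventually_elim (rule sq_integrable_diff)
  ultimately show ?thesis
    using f f' by (simp add: L2_tendsto_iff[OF S] sq_integrable_diff)
qed

lemma L2_tendsto_bounded_mult:
  assumes S: "S \<in> sets borel" and f: "L2_tendsto S f g F"
    and c: "c \<in> borel_measurable (lborel_on S)" "\<And>x. x \<in> S \<Longrightarrow> \<bar>c x\<bar> \<le> 1"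
  shows "L2_tendsto S (\<lambda>i x. c x * f i x) (\<lambda>x. c x * g x) F"
proof -
  note f = f[unfolded L2_tendsto_iff[OF S]]
  have sq: "sq_integrable (lborel_on S) (\<lambda>x. c x * h x)" if "sq_integrable (lborel_on S) h" for h
    by (rule sq_integrable_bounded_mult[OF that c(1), where B = 1]) (use c(2) S in auto)
  have "((\<lambda>i. \<integral>x. (c x * f i x - c x * g x)\<^sup>2 \<partial>lborel_on S) \<longlongrightarrow> 0) F"
  proof (rule Lim_null_comparison)
    show "\<forall>\<^sub>F i in F. norm (\<integral>x. (c x * f i x - c x * g x)\<^sup>2 \<partial>lborel_on S)
        \<le> (\<integral>x. (f i x - g x)\<^sup>2 \<partial>lborel_on S)"
      using f[THEN conjunct1]
    proof eventually_elim
      case (elim i)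
      have d: "sq_integrable (lborel_on S) (\<lambda>x. f i x - g x)"
        using elim f by (intro sq_integrable_diff) auto
      have "(\<integral>x. (c x * (f i x - g x))\<^sup>2 \<partial>lborel_on S) \<le> (\<integral>x. (f i x - g x)\<^sup>2 \<partial>lborel_on S)"
      proof (rule integral_mono[OF sq_integrable_square[OF sq[OF d]] sq_integrable_square[OF d]])
        fix x assume "x \<in> space (lborel_on S)"
        then have "(c x)\<^sup>2 \<le> 1" using c(2)[of x] S by (simp add: abs_square_le_1)
        then have "(c x)\<^sup>2 * (f i x - g x)\<^sup>2 \<le> 1 * (f i x - g x)\<^sup>2" by (intro mult_right_mono) auto
        then show "(c x * (f i x - g x))\<^sup>2 \<le> (f i x - g x)\<^sup>2" by (simp add: power_mult_distrib)
      qed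
      then show ?case by (simp add: right_diff_distrib)
    qed
  qed (use f in auto)
  moreover have "\<forall>\<^sub>F i in F. sq_integrable (lborel_on S) (\<lambda>x. c x * f i x)"
    using f[THEN conjunct1] by eventually_elim (rule sq)
  ultimately show ?thesis using f by (simp add: L2_tendsto_iff[OF S] sq)
qed

lemma sq_integrable_cong_AE:
  assumes "sq_integrable \<nu> f" and "g \<in> borel_measurable \<nu>" and "AE x in \<nu>. f x = g x"
  shows "sq_integrable \<nu> g"
proof -
  have "integrable \<nu> (\<lambda>x. (f x)\<^sup>2) \<longleftrightarrow> integrable \<nu> (\<lambda>x. (g x)\<^sup>2)"
    using assms by (intro integrable_cong_AE) (auto simp: sq_integrable_def)
  then show ?thesis using assms by (simp add: sq_integrable_def)
qed

lemma L2_tendsto_cong_AE: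
  assumes S: "S \<in> sets borel" and f: "L2_tendsto S f g F"
    and m: "g' \<in> borel_measurable (lborel_on S)" and ae: "AE x in lborel_on S. g x = g' x"
  shows "L2_tendsto S f g' F"
proof -
  note f = f[unfolded L2_tendsto_iff[OF S]]
  have g: "g \<in> borel_measurable (lborel_on S)" using f by (simp add: sq_integrable_def)
  have "\<forall>\<^sub>F i in F. (\<integral>x. (f i x - g x)\<^sup>2 \<partial>lborel_on S) = (\<integral>x. (f i x - g' x)\<^sup>2 \<partial>lborel_on S)"
    using f[THEN conjunct1]
  proof eventually_elim
    case (elim i)
    have [measurable]: "f i \<in> borel_measurable (lborel_on S)" using elim by (simp add: sq_integrable_def)
    note [measurable] = g m
    show ?case
      by (rule integral_cong_AE) (use ae in auto)
  qed
  then have "((\<lambda>i. \<integral>x. (f i x - g' x)\<^sup>2 \<partial>lborel_on S) \<longlongrightarrow> 0) F"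
    using f by (simp add: tendsto_cong)
  then show ?thesis
    using f sq_integrable_cong_AE[OF _ m ae] by (simp add: L2_tendsto_iff[OF S])
qed

lemma L2_tendsto_uniform:
  assumes S: "S \<in> sets borel" and "finite_measure (lborel_on S)"
    and f: "\<forall>\<^sub>F i in F. f i \<in> borel_measurable (lborel_on S) \<and> (\<forall>x\<in>S. \<bar>f i x - g x\<bar> \<le> e i)"
    and g: "sq_integrable (lborel_on S) g" and e: "(e \<longlongrightarrow> 0) F"
  shows "L2_tendsto S f g F"
proof -
  interpret finite_measure "lborel_on S" by fact
  have gm: "g \<in> borel_measurable (lborel_on S)" using g by (simp add: sq_integrable_def)
  have d: "sq_integrable (lborel_on S) (\<lambda>x. f i x - g x)"
    if "f i \<in> borel_measurable (lborel_on S) \<and> (\<forall>x\<in>S. \<bar>f i x - g x\<bar> \<le> e i)" for i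
    by (rule sq_integrable_bounded[where B = "e i"]) (use that gm S in \<open>auto intro!: AE_I2\<close>)
  have "((\<lambda>i. \<integral>x. (f i x - g x)\<^sup>2 \<partial>lborel_on S) \<longlongrightarrow> 0) F"
  proof (rule Lim_null_comparison)
    show "\<forall>\<^sub>F i in F. norm (\<integral>x. (f i x - g x)\<^sup>2 \<partial>lborel_on S)
        \<le> (e i)\<^sup>2 * measure (lborel_on S) (space (lborel_on S))"
      using f
    proof eventually_elim
      case (elim i)
      have "(\<integral>x. (f i x - g x)\<^sup>2 \<partial>lborel_on S) \<le> (\<integral>x. (e i)\<^sup>2 \<partial>lborel_on S)"
      proof (rule integral_mono[OF sq_integrable_square[OF d[OF elim]]])
        fix x assume "x \<in> space (lborel_on S)"
        then have "\<bar>f i x - g x\<bar> \<le> e i" using elim S by auto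
        from power_mono[OF this, of 2] show "(f i x - g x)\<^sup>2 \<le> (e i)\<^sup>2" by simp
      qed simp
      then show ?case by (simp add: mult.commute)
    qed
    show "((\<lambda>i. (e i)\<^sup>2 * measure (lborel_on S) (space (lborel_on S))) \<longlongrightarrow> 0) F"
      using tendsto_mult[OF tendsto_power[OF e, of 2] tendsto_const] by simp
  qed
  moreover have "\<forall>\<^sub>F i in F. sq_integrable (lborel_on S) (f i)"
    using f
  proof eventually_elim
    case (elim i)
    from sq_integrable_add[OF d[OF elim] g] show ?case by simp
  qed
  ultimately show ?thesis using g by (simp add: L2_tendsto_iff[OF S])
qed

text \<open>
  Space-time \<open>I \<times> S\<close> with the restricted Lebesgue measure is a product of sigma-finite
  measure spaces, which makes Fubini's theorem applicable to integrals over it.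
\<close>

lemma restrict_space_Times:
  fixes I :: "real set" and S :: "'b::euclidean_space set"
  assumes I: "I \<in> sets borel" and S: "S \<in> sets borel"
  shows "lborel_on I \<Otimes>\<^sub>M lborel_on S = lborel_on (I \<times> S)"
proof (rule pair_measure_eqI)
  have IS: "I \<times> S \<in> sets borel" by (rule borel_Times[OF I S])
  show "sigma_finite_measure (lborel_on I)" "sigma_finite_measure (lborel_on S)"
    using I S by (auto intro!: sigma_finite_measure_restrict_space sigma_finite_lborel)
  show "sets (lborel_on I \<Otimes>\<^sub>M lborel_on S) = sets (lborel_on (I \<times> S))"
  proof
    show "sets (lborel_on I \<Otimes>\<^sub>M lborel_on S) \<subseteq> sets (lborel_on (I \<times> S))"
      unfolding sets_pair_measure
    proof (rule sets.sigma_sets_subset')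
      show "{a \<times> b |a b. a \<in> sets (lborel_on I) \<and> b \<in> sets (lborel_on S)} \<subseteq> sets (lborel_on (I \<times> S))"
      proof clarify
        fix a b assume "a \<in> sets (lborel_on I)" "b \<in> sets (lborel_on S)"
        then have ab: "a \<in> sets borel" "a \<subseteq> I" "b \<in> sets borel" "b \<subseteq> S"
          using I S by (auto simp: sets_restrict_space_iff)
        have "a \<times> b \<in> sets borel" by (rule borel_Times[OF ab(1,3)])
        then show "a \<times> b \<in> sets (lborel_on (I \<times> S))"
          using ab IS by (auto simp: sets_restrict_space_iff)
      qed
      show "space (lborel_on I) \<times> space (lborel_on S) \<in> sets (lborel_on (I \<times> S))"
        using I S IS by (simp add: sets_restrict_space_iff)
    qed
    show "sets (lborel_on (I \<times> S)) \<subseteq> sets (lborel_on I \<Otimes>\<^sub>M lborel_on S)"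
    proof
      fix c assume "c \<in> sets (lborel_on (I \<times> S))"
      then have c: "c \<in> sets (borel \<Otimes>\<^sub>M borel)" "c \<subseteq> I \<times> S"
        unfolding borel_prod using IS by (auto simp: sets_restrict_space_iff)
      have "(\<lambda>p. (fst p, snd p)) \<in> lborel_on I \<Otimes>\<^sub>M lborel_on S \<rightarrow>\<^sub>M borel \<Otimes>\<^sub>M borel"
        by (intro measurable_Pair measurable_compose[OF measurable_fst] measurable_compose[OF measurable_snd]
            measurable_restrict_space1) auto
      from measurable_sets[OF this c(1)] c(2) I S
      show "c \<in> sets (lborel_on I \<Otimes>\<^sub>M lborel_on S)"
        by (simp add: space_pair_measure Int_absorb2)
    qed
  qed
  fix a b assume "a \<in> sets (lborel_on I)" "b \<in> sets (lborel_on S)"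
  then have ab: "a \<in> sets borel" "a \<subseteq> I" "b \<in> sets borel" "b \<subseteq> S"
    using I S by (auto simp: sets_restrict_space_iff)
  then have "emeasure lborel a * emeasure lborel b = emeasure lborel (a \<times> b)"
    using lborel.emeasure_pair_measure_Times[of a lborel b] by (simp add: lborel_prod)
  then show "emeasure (lborel_on I) a * emeasure (lborel_on S) b = emeasure (lborel_on (I \<times> S)) (a \<times> b)"
    using ab I S IS by (subst (1 2 3) emeasure_restrict_space) auto
qed

lemma finite_measure_lborel_on:
  assumes "bounded S" and "S \<in> sets borel"
  shows "finite_measure (lborel_on S)"
  using emeasure_bounded_finite[OF assms(1)] assms(2)
  by (intro finite_measureI) (simp add: emeasure_restrict_space less_top)

text \<open>
  By Fubini's theorem, a set of space-time with null sections at all times is null as soon as it is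
  measurable, which joint measurability of the two functions ensures.
\<close>

lemma AE_lborel_on_Times:
  fixes I :: "real set" and S :: "'b::euclidean_space set" and u v :: "real \<Rightarrow> 'b \<Rightarrow> real"
  assumes I: "I \<in> sets borel" "I \<subseteq> {0<..}" and S: "S \<in> sets borel"
    and u: "(\<lambda>(t, x). u t x) \<in> borel_measurable (lborel_on ({0<..} \<times> S))"
    and v: "(\<lambda>(t, x). v t x) \<in> borel_measurable (lborel_on ({0<..} \<times> S))"
    and eq: "\<And>t. t > 0 \<Longrightarrow> AE x in lborel_on S. u t x = v t x"
  shows "AE p in lborel_on (I \<times> S). u (fst p) (snd p) = v (fst p) (snd p)"
proof -
  interpret I: sigma_finite_measure "lborel_on I"
    using I by (auto intro!: sigma_finite_measure_restrict_space sigma_finite_lborel)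
  interpret S: sigma_finite_measure "lborel_on S"
    using S by (auto intro!: sigma_finite_measure_restrict_space sigma_finite_lborel)
  interpret pair_sigma_finite "lborel_on I" "lborel_on S" ..
  have IS: "I \<times> S \<in> sets borel" by (rule borel_Times[OF I(1) S])
  have sub: "lborel_on (I \<times> S) = restrict_space (lborel_on ({0<..} \<times> S)) (I \<times> S)"
    using I(2) IS borel_Times[OF borel_open[OF open_greaterThan] S, of "0 :: real"]
    by (subst restrict_restrict_space) (auto intro!: arg_cong[where f = "restrict_space lborel"])
  have [measurable]: "(\<lambda>p. u (fst p) (snd p)) \<in> borel_measurable (lborel_on I \<Otimes>\<^sub>M lborel_on S)"
    "(\<lambda>p. v (fst p) (snd p)) \<in> borel_measurable (lborel_on I \<Otimes>\<^sub>M lborel_on S)"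
    using u v unfolding restrict_space_Times[OF I(1) S] sub
    by (auto intro!: measurable_restrict_space1 simp: split_beta')
  have "AE p in lborel_on I \<Otimes>\<^sub>M lborel_on S. u (fst p) (snd p) = v (fst p) (snd p)"
  proof (rule AE_pair_measure)
    show "{p \<in> space (lborel_on I \<Otimes>\<^sub>M lborel_on S). u (fst p) (snd p) = v (fst p) (snd p)}
        \<in> sets (lborel_on I \<Otimes>\<^sub>M lborel_on S)" by measurable
    show "AE t in lborel_on I. AE x in lborel_on S. u (fst (t, x)) (snd (t, x)) = v (fst (t, x)) (snd (t, x))"
    proof (rule AE_I2)
      fix t assume "t \<in> space (lborel_on I)"
      then have "t > 0" using I by auto
      then show "AE x in lborel_on S. u (fst (t, x)) (snd (t, x)) = v (fst (t, x)) (snd (t, x))"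
        using eq by simp
    qed
  qed
  then show ?thesis unfolding restrict_space_Times[OF I(1) S] .
qed

section \<open>The evolution equation of a mixture\<close>

lemma solves_from_zeroD:
  assumes S: "S \<in> sets borel" and u: "solves_from_zero S u F"
  shows "(\<lambda>(t, x). u t x) \<in> borel_measurable (lborel_on ({0<..} \<times> S))"
    and "t \<ge> 0 \<Longrightarrow> sq_integrable (lborel_on S) (u t)"
    and "x \<in> S \<Longrightarrow> u 0 x = 0"
    and "L2_tendsto S u (u 0) (at_right 0)"
    and "t > 0 \<Longrightarrow> L2_tendsto S (\<lambda>s x. (u s x - u t x) / (s - t)) (F t) (at t)"
proof -
  have IS: "({0<..} :: real set) \<times> S \<in> sets borel"
    by (rule borel_Times[OF borel_open[OF open_greaterThan] S])
  show "(\<lambda>(t, x). u t x) \<in> borel_measurable (lborel_on ({0<..} \<times> S))"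
    "t \<ge> 0 \<Longrightarrow> sq_integrable (lborel_on S) (u t)" "x \<in> S \<Longrightarrow> u 0 x = 0"
    "L2_tendsto S u (u 0) (at_right 0)"
    "t > 0 \<Longrightarrow> L2_tendsto S (\<lambda>s x. (u s x - u t x) / (s - t)) (F t) (at t)"
    using u by (auto simp: solves_from_zero_def set_borel_measurable_iff[OF IS] L2_iff[OF S])
qed

lemma solves_from_zeroI:
  assumes S: "S \<in> sets borel"
    and "(\<lambda>(t, x). u t x) \<in> borel_measurable (lborel_on ({0<..} \<times> S))"
    and "\<And>t. t \<ge> 0 \<Longrightarrow> sq_integrable (lborel_on S) (u t)"
    and "\<And>x. x \<in> S \<Longrightarrow> u 0 x = 0"
    and "L2_tendsto S u (u 0) (at_right 0)"
    and "\<And>t. t > 0 \<Longrightarrow> L2_tendsto S (\<lambda>s x. (u s x - u t x) / (s - t)) (F t) (at t)"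
  shows "solves_from_zero S u F"
proof -
  have IS: "({0<..} :: real set) \<times> S \<in> sets borel"
    by (rule borel_Times[OF borel_open[OF open_greaterThan] S])
  show ?thesis
    using assms by (auto simp: solves_from_zero_def set_borel_measurable_iff[OF IS] L2_iff[OF S])
qed

lemma solves_from_zero_cong_AE:
  assumes S: "S \<in> sets borel" and u: "solves_from_zero S u F"
    and m: "\<And>t. t > 0 \<Longrightarrow> F' t \<in> borel_measurable (lborel_on S)"
    and ae: "\<And>t. t > 0 \<Longrightarrow> AE x in lborel_on S. F t x = F' t x"
  shows "solves_from_zero S u F'"
  by (rule solves_from_zeroI[OF S solves_from_zeroD(1-4)[OF S u]])
     (auto intro: L2_tendsto_cong_AE[OF S solves_from_zeroD(5)[OF S u] m ae])

lemma solves_from_zero_bounded_mult: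
  assumes S: "S \<in> sets borel" and u: "solves_from_zero S u F"
    and c: "c \<in> borel_measurable (lborel_on S)" "\<And>x. x \<in> S \<Longrightarrow> \<bar>c x\<bar> \<le> 1"
  shows "solves_from_zero S (\<lambda>t x. c x * u t x) (\<lambda>t x. c x * F t x)"
proof (rule solves_from_zeroI[OF S])
  note D = solves_from_zeroD[OF S u]
  have I: "({0<..} :: real set) \<in> sets borel" by simp
  have "(\<lambda>p. c (snd p)) \<in> borel_measurable (lborel_on ({0<..} :: real set) \<Otimes>\<^sub>M lborel_on S)"
    by (rule measurable_compose[OF measurable_snd c(1)])
  then have "(\<lambda>p. c (snd p) * (case p of (t, x) \<Rightarrow> u t x)) \<in> borel_measurable (lborel_on ({0<..} \<times> S))"
    using D(1) unfolding restrict_space_Times[OF I S] by (rule borel_measurable_times)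
  then show "(\<lambda>(t, x). c x * u t x) \<in> borel_measurable (lborel_on ({0<..} \<times> S))"
    by (simp add: split_beta')
  show "sq_integrable (lborel_on S) (\<lambda>x. c x * u t x)" if "t \<ge> 0" for t
    by (rule sq_integrable_bounded_mult[OF D(2)[OF that] c(1), where B = 1]) (use c(2) S in auto)
  show "L2_tendsto S (\<lambda>t x. c x * u t x) (\<lambda>x. c x * u 0 x) (at_right 0)"
    by (rule L2_tendsto_bounded_mult[OF S D(4) c])
  show "L2_tendsto S (\<lambda>s x. (c x * u s x - c x * u t x) / (s - t)) (\<lambda>x. c x * F t x) (at t)"
    if "t > 0" for t
    using L2_tendsto_bounded_mult[OF S D(5)[OF that] c] by (simp add: right_diff_distrib)
qed (use solves_from_zeroD(3)[OF S u] in simp)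

locale domain_mixture = mixture "lborel_on \<Omega>" K \<kappa>
  for \<Omega> :: "'a::euclidean_space set" and K :: "'i::finite \<Rightarrow> 'i \<Rightarrow> 'a \<Rightarrow> 'a \<Rightarrow> real" and \<kappa> +
  assumes \<Omega>_borel: "\<Omega> \<in> sets borel"
begin

lemma space_lborel_on [simp]: "space (lborel_on \<Omega>) = \<Omega>"
  using \<Omega>_borel by simp

definition solves_mixture ::
  "('i \<Rightarrow> 'a \<Rightarrow> real) \<Rightarrow> ('i \<Rightarrow> 'a \<Rightarrow> real) \<Rightarrow> ('i \<Rightarrow> real \<Rightarrow> 'a \<Rightarrow> real) \<Rightarrow> bool" where
  "solves_mixture \<theta> S u \<longleftrightarrow> (\<forall>i. solves_from_zero \<Omega> (u i)
     (\<lambda>t x. exchange \<theta> (\<lambda>j. u j t) i x + exp (- t) * (S i x * \<theta> i x)))"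

lemma solves_mixtureD:
  "solves_mixture \<theta> S u \<Longrightarrow> solves_from_zero \<Omega> (u i)
     (\<lambda>t x. exchange \<theta> (\<lambda>j. u j t) i x + exp (- t) * (S i x * \<theta> i x))"
  by (simp add: solves_mixture_def)

text \<open>
  The sources cancel in the difference of two solutions, which leaves the homogeneous equation.
\<close>

lemma solves_mixture_unique:
  assumes \<theta>: "bounded_family 1 \<theta>" and u: "solves_mixture \<theta> S u" and v: "solves_mixture \<theta> S v" and t: "t > 0"
  shows "AE x in lborel_on \<Omega>. u i t x = v i t x"
proof -
  note Du = solves_from_zeroD[OF \<Omega>_borel solves_mixtureD[OF u]]
  note Dv = solves_from_zeroD[OF \<Omega>_borel solves_mixtureD[OF v]]
  define w where "w = (\<lambda>i t x. u i t x - v i t x)"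
  have int: "integrable (lborel_on \<Omega>) (u i t)" "integrable (lborel_on \<Omega>) (v i t)" if "t > 0" for i t
    using that by (auto intro!: sq_integrable_integrable Du(2) Dv(2))
  have wsq: "sq_integrable (lborel_on \<Omega>) (w i s)" if "s > 0" for i s
    unfolding w_def using that by (intro sq_integrable_diff Du(2) Dv(2)) auto
  have "AE x in lborel_on \<Omega>. w i t x = 0"
  proof (rule exchange_flow_unique[OF \<theta> wsq _ _ t])
    fix i
    have "((\<lambda>s. \<integral>x. (w i s x - w i 0 x)\<^sup>2 \<partial>lborel_on \<Omega>) \<longlongrightarrow> 0) (at_right 0)"
      using L2_tendsto_diff[OF \<Omega>_borel Du(4)[of i] Dv(4)[of i]]
      by (simp add: L2_tendsto_iff[OF \<Omega>_borel] w_def)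
    moreover have "(\<integral>x. (w i s x - w i 0 x)\<^sup>2 \<partial>lborel_on \<Omega>) = (\<integral>x. (w i s x)\<^sup>2 \<partial>lborel_on \<Omega>)" for s
      by (rule Bochner_Integration.integral_cong) (auto simp: w_def Du(3) Dv(3))
    ultimately show "((\<lambda>s. \<integral>x. (w i s x)\<^sup>2 \<partial>lborel_on \<Omega>) \<longlongrightarrow> 0) (at_right 0)" by simp
  next
    fix i t assume t: "t > (0 :: real)"
    have "((\<lambda>s. \<integral>x. (((u i s x - u i t x) / (s - t) - (v i s x - v i t x) / (s - t))
          - ((exchange \<theta> (\<lambda>j. u j t) i x + exp (- t) * (S i x * \<theta> i x))
             - (exchange \<theta> (\<lambda>j. v j t) i x + exp (- t) * (S i x * \<theta> i x))))\<^sup>2 \<partial>lborel_on \<Omega>) \<longlongrightarrow> 0) (at t)"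
      using L2_tendsto_diff[OF \<Omega>_borel Du(5)[OF t, of i] Dv(5)[OF t, of i]]
      by (simp add: L2_tendsto_iff[OF \<Omega>_borel])
    moreover have "(\<integral>x. (((u i s x - u i t x) / (s - t) - (v i s x - v i t x) / (s - t))
          - ((exchange \<theta> (\<lambda>j. u j t) i x + exp (- t) * (S i x * \<theta> i x))
             - (exchange \<theta> (\<lambda>j. v j t) i x + exp (- t) * (S i x * \<theta> i x))))\<^sup>2 \<partial>lborel_on \<Omega>)
        = (\<integral>x. ((w i s x - w i t x) / (s - t) - exchange \<theta> (\<lambda>j. w j t) i x)\<^sup>2 \<partial>lborel_on \<Omega>)" for s
    proof (rule Bochner_Integration.integral_cong[OF refl])
      fix x assume "x \<in> space (lborel_on \<Omega>)"
      then have "exchange \<theta> (\<lambda>j. w j t) i x = exchange \<theta> (\<lambda>j. u j t) i x - exchange \<theta> (\<lambda>j. v j t) i x"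
        unfolding w_def by (intro exchange_diff int t)
      moreover have "(w i s x - w i t x) / (s - t) = (u i s x - u i t x) / (s - t) - (v i s x - v i t x) / (s - t)"
        by (simp add: w_def diff_divide_distrib)
      ultimately show "(((u i s x - u i t x) / (s - t) - (v i s x - v i t x) / (s - t))
          - ((exchange \<theta> (\<lambda>j. u j t) i x + exp (- t) * (S i x * \<theta> i x))
             - (exchange \<theta> (\<lambda>j. v j t) i x + exp (- t) * (S i x * \<theta> i x))))\<^sup>2
        = ((w i s x - w i t x) / (s - t) - exchange \<theta> (\<lambda>j. w j t) i x)\<^sup>2" by simp
    qed
    ultimately show "((\<lambda>s. \<integral>x. ((w i s x - w i t x) / (s - t) - exchange \<theta> (\<lambda>j. w j t) i x)\<^sup>2 \<partial>lborel_on \<Omega>)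
        \<longlongrightarrow> 0) (at t)" by simp
  qed
  then show ?thesis by (simp add: w_def)
qed

lemma flow_jointly_measurable:
  assumes \<theta>: "bounded_family 1 \<theta>" and S: "bounded_family \<sigma> S" and \<sigma>: "0 \<le> \<sigma>" and I: "I \<in> sets borel"
  shows "(\<lambda>(t, x). flow \<theta> S i t x) \<in> borel_measurable (lborel_on (I \<times> \<Omega>))"
proof -
  have [measurable]: "(\<lambda>p. coef \<theta> S k i (snd p)) \<in> borel_measurable (lborel_on I \<Otimes>\<^sub>M lborel_on \<Omega>)" for k
    by (rule measurable_compose[OF measurable_snd coef_measurable[OF \<theta> S \<sigma>]])
  have "(\<lambda>t :: real. t) \<in> borel_measurable (lborel_on I)" by (intro measurable_restrict_space1) simp
  from measurable_compose[OF measurable_fst[of "lborel_on I" "lborel_on \<Omega>"] this]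
  have [measurable]: "fst \<in> borel_measurable (lborel_on I \<Otimes>\<^sub>M lborel_on \<Omega>)" by simp
  have "(\<lambda>p. \<Sum>k. coef \<theta> S k i (snd p) * fst p ^ k / fact k)
      \<in> borel_measurable (lborel_on I \<Otimes>\<^sub>M lborel_on \<Omega>)" by measurable
  then show ?thesis
    by (simp add: flow_def egf_def split_beta' restrict_space_Times[OF I \<Omega>_borel])
qed

text \<open>
  The Lipschitz bound and the Taylor remainder of \<open>egf\<close> hold uniformly in \<open>x\<close>, hence in \<open>L\<^sup>2\<close>.
\<close>

lemma flow_solves:
  assumes \<theta>: "bounded_family 1 \<theta>" and S: "bounded_family \<sigma> S" and \<sigma>: "0 \<le> \<sigma>"
  shows "solves_mixture \<theta> S (flow \<theta> S)"
  unfolding solves_mixture_def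
proof (intro allI solves_from_zeroI[OF \<Omega>_borel])
  fix i
  let ?F = "\<lambda>t x. exchange \<theta> (\<lambda>j. flow \<theta> S j t) i x + exp (- t) * (S i x * \<theta> i x)"
  note b = coef_bound[OF \<theta> S \<sigma>, unfolded space_lborel_on]
  have fin: "finite_measure (lborel_on \<Omega>)" by unfold_locales
  have m: "flow \<theta> S i t \<in> borel_measurable (lborel_on \<Omega>)" for i t
    by (rule flow_measurable[OF \<theta> S \<sigma>])
  have sq: "sq_integrable (lborel_on \<Omega>) (flow \<theta> S i t)" for i t
    by (rule sq_integrable_bounded[OF m, where B = "exp (growth \<sigma> * \<bar>t\<bar>)"])
       (intro AE_I2 flow_bound[OF \<theta> S \<sigma>] order_refl)
  show "(\<lambda>(t, x). flow \<theta> S i t x) \<in> borel_measurable (lborel_on ({0<..} \<times> \<Omega>))"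
    by (rule flow_jointly_measurable[OF \<theta> S \<sigma>]) simp
  show "sq_integrable (lborel_on \<Omega>) (flow \<theta> S i t)" for t by (rule sq)
  show "flow \<theta> S i 0 x = 0" for x by (simp add: flow_def)
  show "L2_tendsto \<Omega> (flow \<theta> S i) (flow \<theta> S i 0) (at_right 0)"
  proof (rule L2_tendsto_uniform[OF \<Omega>_borel fin _ sq])
    have "\<forall>\<^sub>F t :: real in at_right 0. 0 < t \<and> t < 1"
      by (auto simp: eventually_at_right_field intro: exI[of _ 1])
    then show "\<forall>\<^sub>F t in at_right 0. flow \<theta> S i t \<in> borel_measurable (lborel_on \<Omega>) \<and>
        (\<forall>x\<in>\<Omega>. \<bar>flow \<theta> S i t x - flow \<theta> S i 0 x\<bar> \<le> 1 * growth \<sigma> * exp (growth \<sigma> * 1) * \<bar>t - 0\<bar>)"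
    proof eventually_elim
      case (elim t)
      then show ?case
        unfolding flow_def[of _ _ _ _ "_ :: 'a"]
        by (intro conjI ballI m[unfolded flow_def] egf_lipschitz[OF b]) auto
    qed
    have "((\<lambda>t. 1 * growth \<sigma> * exp (growth \<sigma> * 1) * \<bar>t - 0\<bar>)
        \<longlongrightarrow> 1 * growth \<sigma> * exp (growth \<sigma> * 1) * \<bar>0 - 0\<bar>) (at_right 0)"
      by (intro tendsto_intros)
    then show "((\<lambda>t. 1 * growth \<sigma> * exp (growth \<sigma> * 1) * \<bar>t - 0\<bar>) \<longlongrightarrow> 0) (at_right 0)" by simp
  qed
  fix t :: real assume "t > 0"
  show "L2_tendsto \<Omega> (\<lambda>s x. (flow \<theta> S i s x - flow \<theta> S i t x) / (s - t)) (?F t) (at t)"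
  proof (rule L2_tendsto_uniform[OF \<Omega>_borel fin])
    let ?C = "1 * growth \<sigma> * growth \<sigma> * exp (growth \<sigma> * (\<bar>t\<bar> + 1))"
    have "\<forall>\<^sub>F s in at t. s \<noteq> t \<and> \<bar>s\<bar> \<le> \<bar>t\<bar> + 1"
      by (auto simp: eventually_at dist_real_def intro!: exI[of _ 1])
    then show "\<forall>\<^sub>F s in at t. (\<lambda>x. (flow \<theta> S i s x - flow \<theta> S i t x) / (s - t)) \<in> borel_measurable (lborel_on \<Omega>)
        \<and> (\<forall>x\<in>\<Omega>. \<bar>(flow \<theta> S i s x - flow \<theta> S i t x) / (s - t) - ?F t x\<bar> \<le> ?C * \<bar>s - t\<bar>)"
    proof eventually_elim
      case (elim s)
      show ?case
      proof (intro conjI ballI)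
        show "(\<lambda>x. (flow \<theta> S i s x - flow \<theta> S i t x) / (s - t)) \<in> borel_measurable (lborel_on \<Omega>)"
          by (intro borel_measurable_divide borel_measurable_diff m borel_measurable_const)
        fix x assume x: "x \<in> \<Omega>"
        have "?F t x = egf (\<lambda>k. coef \<theta> S (Suc k) i x) t"
          by (rule egf_coef_Suc[OF \<theta> S \<sigma>, symmetric]) (use x in simp)
        moreover have "\<bar>(egf (\<lambda>k. coef \<theta> S k i x) s - egf (\<lambda>k. coef \<theta> S k i x) t) / (s - t)
            - egf (\<lambda>k. coef \<theta> S (Suc k) i x) t\<bar> \<le> ?C * \<bar>s - t\<bar>"
          by (rule egf_difference_quotient[OF b[OF x]]) (use elim in auto)
        ultimately show "\<bar>(flow \<theta> S i s x - flow \<theta> S i t x) / (s - t) - ?F t x\<bar> \<le> ?C * \<bar>s - t\<bar>"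
          by (simp only: flow_def)
      qed
    qed
    have "((\<lambda>s. ?C * \<bar>s - t\<bar>) \<longlongrightarrow> ?C * \<bar>t - t\<bar>) (at t)" by (intro tendsto_intros)
    then show "((\<lambda>s. ?C * \<bar>s - t\<bar>) \<longlongrightarrow> 0) (at t)" by simp
    have "sq_integrable (lborel_on \<Omega>) (\<lambda>x. \<theta> i x * S i x)"
      by (rule sq_integrable_bounded_mult[OF sq_integrable_bounded bounded_familyD[OF \<theta>]])
         (auto intro: bounded_familyD[OF S] intro!: AE_I2)
    then show "sq_integrable (lborel_on \<Omega>) (?F t)"
      by (intro sq_integrable_add sq_integrable_cmult energy_estimate(1)[OF \<theta>] sq) (simp add: mult.commute)
  qed
qed

text \<open>
  Continuous dependence on the volume fractions for arbitrary solutions: by uniqueness they agree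
  almost everywhere with their power series, and square-integrable test functions are integrable on
  the bounded space-time domain.
\<close>

lemma flow_weakly_L2:
  assumes \<theta>n: "\<And>n. bounded_family 1 (\<theta>n n)" and \<theta>: "bounded_family 1 \<theta>"
    and S: "bounded_family \<sigma> S" and \<sigma>: "0 \<le> \<sigma>"
    and weak: "\<And>i. weak_star (lborel_on \<Omega>) (\<lambda>n. \<theta>n n i) (\<theta> i)"
    and v: "\<And>n. solves_mixture (\<theta>n n) S (v n)"
    and \<Omega>: "bounded \<Omega>"
  shows "weakly_L2 ({0<..<T} \<times> \<Omega>) (\<lambda>n (t, x). v n i t x) (\<lambda>(t, x). flow \<theta> S i t x)"
proof -
  let ?Q = "{0<..<T} \<times> \<Omega>" and ?\<nu> = "lborel_on ({0<..<T} \<times> \<Omega>)"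
  have I: "{0<..<T} \<in> sets borel" by simp
  have Q: "?Q \<in> sets borel" by (rule borel_Times[OF I \<Omega>_borel])
  have "bounded {0<..<T}" by (rule bounded_subset[of "{0..T}"]) auto
  then have "bounded ?Q" by (intro bounded_Times \<Omega>)
  then interpret Q: finite_measure ?\<nu> using Q by (rule finite_measure_lborel_on)
  have eq: "AE p in ?\<nu>. v n i (fst p) (snd p) = flow (\<theta>n n) S i (fst p) (snd p)" for n
    by (rule AE_lborel_on_Times[OF I _ \<Omega>_borel solves_from_zeroD(1)[OF \<Omega>_borel solves_mixtureD[OF v]]
          flow_jointly_measurable[OF \<theta>n S \<sigma>] solves_mixture_unique[OF \<theta>n v flow_solves[OF \<theta>n S \<sigma>]]]) auto
  have fm: "(\<lambda>p. flow \<theta>' S i (fst p) (snd p)) \<in> borel_measurable ?\<nu>" if "bounded_family 1 \<theta>'" for \<theta>'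
    using flow_jointly_measurable[OF that S \<sigma> I, of i] by (simp add: split_beta')
  have sub: "?\<nu> = restrict_space (lborel_on ({0<..} \<times> \<Omega>)) ?Q"
    using Q borel_Times[OF borel_open[OF open_greaterThan] \<Omega>_borel, of "0 :: real"]
    by (subst restrict_restrict_space) (auto intro!: arg_cong[where f = "restrict_space lborel"])
  have vm: "(\<lambda>p. v n i (fst p) (snd p)) \<in> borel_measurable ?\<nu>" for n
    unfolding sub using solves_from_zeroD(1)[OF \<Omega>_borel solves_mixtureD[OF v[of n], of i]]
    by (auto intro!: measurable_restrict_space1 simp: split_beta')
  have fsq: "sq_integrable ?\<nu> (\<lambda>p. flow \<theta>' S i (fst p) (snd p))" if "bounded_family 1 \<theta>'" for \<theta>'
  proof (rule Q.sq_integrable_bounded[OF fm[OF that], where B = "exp (growth \<sigma> * T)"], rule AE_I2)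
    fix p assume "p \<in> space ?\<nu>"
    then have "snd p \<in> \<Omega>" "\<bar>fst p\<bar> \<le> T" using Q by auto
    then show "\<bar>flow \<theta>' S i (fst p) (snd p)\<bar> \<le> exp (growth \<sigma> * T)"
      by (intro flow_bound[OF that S \<sigma>]) auto
  qed
  have vsq: "sq_integrable ?\<nu> (\<lambda>p. v n i (fst p) (snd p))" for n
    by (rule sq_integrable_cong_AE[OF fsq[OF \<theta>n] vm]) (use eq in \<open>auto simp: eq_commute\<close>)
  have lim: "(\<lambda>n. \<integral>p. v n i (fst p) (snd p) * \<phi> p \<partial>?\<nu>) \<longlonglongrightarrow> (\<integral>p. flow \<theta> S i (fst p) (snd p) * \<phi> p \<partial>?\<nu>)"
    if \<phi>: "sq_integrable ?\<nu> \<phi>" for \<phi>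
  proof -
    have [measurable]: "\<phi> \<in> borel_measurable ?\<nu>" using \<phi> by (simp add: sq_integrable_def)
    note [measurable] = vm fm
    have "(\<lambda>n. \<integral>p. \<phi> p * flow (\<theta>n n) S i (fst p) (snd p) \<partial>?\<nu>)
        \<longlonglongrightarrow> (\<integral>p. \<phi> p * flow \<theta> S i (fst p) (snd p) \<partial>?\<nu>)"
      unfolding restrict_space_Times[OF I \<Omega>_borel, symmetric]
    proof (rule flow_weak_convergence[OF \<theta>n \<theta> S \<sigma> weak, where r = T])
      show "sigma_finite_measure (lborel_on {0<..<T})"
        by (intro sigma_finite_measure_restrict_space sigma_finite_lborel) simp
      show "integrable (lborel_on {0<..<T} \<Otimes>\<^sub>M lborel_on \<Omega>) \<phi>"
        using Q.sq_integrable_integrable[OF \<phi>] by (simp add: restrict_space_Times[OF I \<Omega>_borel])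
    qed (auto intro!: measurable_restrict_space1)
    moreover have "(\<integral>p. \<phi> p * flow (\<theta>n n) S i (fst p) (snd p) \<partial>?\<nu>) = (\<integral>p. v n i (fst p) (snd p) * \<phi> p \<partial>?\<nu>)" for n
    proof (rule integral_cong_AE)
      show "(\<lambda>p. \<phi> p * flow (\<theta>n n) S i (fst p) (snd p)) \<in> borel_measurable ?\<nu>"
        by (intro borel_measurable_times fm \<theta>n) measurable
      show "AE p in ?\<nu>. \<phi> p * flow (\<theta>n n) S i (fst p) (snd p) = v n i (fst p) (snd p) * \<phi> p"
        using eq[of n] by eventually_elim simp
    qed measurable
    ultimately show ?thesis by (simp add: mult.commute)
  qed
  show ?thesis
    unfolding weakly_L2_def set_integral_eq[OF Q]
    using vsq fsq[OF \<theta>] lim by (simp add: split_beta' L2_iff[OF Q])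
qed

end

lemma weakly_L2_cong:
  assumes f: "weakly_L2 S f g" and eq: "\<And>k x. x \<in> S \<Longrightarrow> f k x = h k x"
  shows "weakly_L2 S h g"
proof -
  have "(\<lambda>x. indicator S x *\<^sub>R h k x) = (\<lambda>x. indicator S x *\<^sub>R f k x)"
    "(\<lambda>x. indicator S x *\<^sub>R (h k x)\<^sup>2) = (\<lambda>x. indicator S x *\<^sub>R (f k x)\<^sup>2)"
    "(\<lambda>x. indicator S x *\<^sub>R (h k x * \<phi> x)) = (\<lambda>x. indicator S x *\<^sub>R (f k x * \<phi> x))" for k \<phi>
    using eq by (auto simp: indicator_def)
  then show ?thesis
    using f by (simp add: weakly_L2_def L2_def set_borel_measurable_def set_integrable_def
        set_lebesgue_integral_def)
qed

lemma weakly_L2_add: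
  assumes S: "S \<in> sets borel" and f: "weakly_L2 S f g" and f': "weakly_L2 S f' g'"
  shows "weakly_L2 S (\<lambda>k x. f k x + f' k x) (\<lambda>x. g x + g' x)"
proof -
  have *: "sq_integrable (lborel_on S) (f k)" "sq_integrable (lborel_on S) (f' k)"
    "sq_integrable (lborel_on S) g" "sq_integrable (lborel_on S) g'" for k
    using f f' by (auto simp: weakly_L2_def L2_iff[OF S])
  have "(\<lambda>k. \<integral>x. (f k x + f' k x) * \<phi> x \<partial>lborel_on S) \<longlonglongrightarrow> (\<integral>x. (g x + g' x) * \<phi> x \<partial>lborel_on S)"
    if \<phi>: "sq_integrable (lborel_on S) \<phi>" for \<phi>
  proof -
    have "(\<integral>x. (f k x + f' k x) * \<phi> x \<partial>lborel_on S)
        = (\<integral>x. f k x * \<phi> x \<partial>lborel_on S) + (\<integral>x. f' k x * \<phi> x \<partial>lborel_on S)" for k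
      using sq_integrable_mult[OF *(1) \<phi>] sq_integrable_mult[OF *(2) \<phi>] by (simp add: distrib_right)
    moreover have "(\<integral>x. (g x + g' x) * \<phi> x \<partial>lborel_on S)
        = (\<integral>x. g x * \<phi> x \<partial>lborel_on S) + (\<integral>x. g' x * \<phi> x \<partial>lborel_on S)"
      using sq_integrable_mult[OF *(3) \<phi>] sq_integrable_mult[OF *(4) \<phi>] by (simp add: distrib_right)
    ultimately show ?thesis
      using f f' \<phi> by (auto simp: weakly_L2_def L2_iff[OF S] set_integral_eq[OF S] intro!: tendsto_add)
  qed
  then show ?thesis
    unfolding weakly_L2_def set_integral_eq[OF S]
    using * by (auto simp: L2_iff[OF S] intro!: sq_integrable_add)
qed

section \<open>Two phases\<close>

lemma solves_from_zero_cong: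
  assumes S: "S \<in> sets borel" and u: "solves_from_zero S u F"
    and eq: "\<And>t x. t > 0 \<Longrightarrow> x \<in> S \<Longrightarrow> F t x = F' t x"
  shows "solves_from_zero S u F'"
proof (rule solves_from_zero_cong_AE[OF S u])
  fix t :: real assume t: "t > 0"
  have "F t \<in> borel_measurable (lborel_on S)"
    using solves_from_zeroD(5)[OF S u t] by (simp add: L2_tendsto_iff[OF S] sq_integrable_def)
  then show "F' t \<in> borel_measurable (lborel_on S)"
    by (rule measurable_cong[THEN iffD1, rotated]) (use eq t S in simp)
  show "AE x in lborel_on S. F t x = F' t x" using eq t S by (intro AE_I2) simp
qed

text \<open>
  The phases are indexed by \<open>bool\<close>, with \<open>True\<close> for the sets \<open>A n\<close> and \<open>False\<close> for the sets
  \<open>B n\<close>.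
\<close>

definition phase_fraction :: "('a \<Rightarrow> real) \<Rightarrow> bool \<Rightarrow> 'a \<Rightarrow> real" where
  "phase_fraction X i x = (if i then X x else 1 - X x)"

definition phase_kernels :: "('a \<Rightarrow> 'a \<Rightarrow> real) \<Rightarrow> ('a \<Rightarrow> 'a \<Rightarrow> real) \<Rightarrow> ('a \<Rightarrow> 'a \<Rightarrow> real) \<Rightarrow>
    bool \<Rightarrow> bool \<Rightarrow> 'a \<Rightarrow> 'a \<Rightarrow> real" where
  "phase_kernels J G R i j = (if i then if j then J else R else if j then R else G)"

lemma (in mixture) exchange_eq_integral:
  assumes "\<And>j. integrable \<mu> (f j)" and "\<And>j. integrable \<mu> (\<theta> j)" and "x \<in> space \<mu>"
  shows "exchange \<theta> f i x = (\<Sum>j\<in>UNIV. \<integral>y. K i j x y * (\<theta> i x * f j y - \<theta> j y * f i x) \<partial>\<mu>)"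
proof -
  have "(\<integral>y. K i j x y * (\<theta> i x * f j y - \<theta> j y * f i x) \<partial>\<mu>)
      = (\<integral>y. \<theta> i x * (K i j x y * f j y) - f i x * (K i j x y * \<theta> j y) \<partial>\<mu>)" for j
    by (intro Bochner_Integration.integral_cong refl) (simp add: algebra_simps)
  also have "\<dots> j = \<theta> i x * (\<integral>y. K i j x y * f j y \<partial>\<mu>) - f i x * (\<integral>y. K i j x y * \<theta> j y \<partial>\<mu>)" for j
    using K_mult_integrable[OF assms(1,3)] K_mult_integrable[OF assms(2,3)] by simp
  finally show ?thesis
    by (simp add: exchange_def gain_def sum_subtractf sum_distrib_left)
qed

text \<open>
  Volume fractions that agree almost everywhere give the same equation in \<open>L\<^sup>2\<close>. This allows \<open>X\<close>
  to be replaced by a representative with values in \<open>[0, 1]\<close> everywhere.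
\<close>

lemma (in domain_mixture) solves_mixture_cong_AE:
  assumes u: "solves_mixture \<theta> S u"
    and m: "\<And>i. \<theta> i \<in> borel_measurable (lborel_on \<Omega>)" "\<And>i. \<theta>' i \<in> borel_measurable (lborel_on \<Omega>)"
    and S: "\<And>i. S i \<in> borel_measurable (lborel_on \<Omega>)"
    and ae: "\<And>i. AE x in lborel_on \<Omega>. \<theta> i x = \<theta>' i x"
  shows "solves_mixture \<theta>' S u"
  unfolding solves_mixture_def
proof
  fix i
  have gain_eq: "gain \<theta> i x = gain \<theta>' i x" if x: "x \<in> \<Omega>" for x
    unfolding gain_def
  proof (intro sum.cong refl integral_cong_AE)
    fix j
    have "K i j x \<in> borel_measurable (lborel_on \<Omega>)" by (rule K_section_measurable) (use x in simp)
    then show "(\<lambda>y. K i j x y * \<theta> j y) \<in> borel_measurable (lborel_on \<Omega>)"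
      "(\<lambda>y. K i j x y * \<theta>' j y) \<in> borel_measurable (lborel_on \<Omega>)"
      by (intro borel_measurable_times m; simp)+
    show "AE y in lborel_on \<Omega>. K i j x y * \<theta> j y = K i j x y * \<theta>' j y"
      using ae[of j] by eventually_elim simp
  qed
  show "solves_from_zero \<Omega> (u i)
      (\<lambda>t x. exchange \<theta>' (\<lambda>j. u j t) i x + exp (- t) * (S i x * \<theta>' i x))"
  proof (rule solves_from_zero_cong_AE[OF \<Omega>_borel solves_mixtureD[OF u]])
    fix t :: real assume "t > 0"
    then have um: "u j t \<in> borel_measurable (lborel_on \<Omega>)" for j
      using solves_from_zeroD(2)[OF \<Omega>_borel solves_mixtureD[OF u], of t j]
      by (simp add: sq_integrable_def)
    show "(\<lambda>x. exchange \<theta>' (\<lambda>j. u j t) i x + exp (- t) * (S i x * \<theta>' i x))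
        \<in> borel_measurable (lborel_on \<Omega>)"
      by (intro borel_measurable_add borel_measurable_times exchange_measurable m um S) simp
    show "AE x in lborel_on \<Omega>. exchange \<theta> (\<lambda>j. u j t) i x + exp (- t) * (S i x * \<theta> i x)
        = exchange \<theta>' (\<lambda>j. u j t) i x + exp (- t) * (S i x * \<theta>' i x)"
      using ae[of i] AE_space
      by eventually_elim (simp add: exchange_def gain_eq)
  qed
qed

locale two_phase = domain_mixture \<Omega> "phase_kernels J G R" \<kappa>
  for \<Omega> :: "'a::euclidean_space set" and J G R \<kappa>
begin

text \<open>
  Only integrability of \<open>X\<close> is assumed, because the given volume fraction lies in \<open>[0, 1]\<close> only
  almost everywhere.
\<close>

lemma limit_systemI:
  assumes u: "solves_mixture (phase_fraction X) S u" and X: "integrable (lborel_on \<Omega>) X"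
    and S: "S True = Ka xb" "S False = Kb xb"
  shows "limit_system \<Omega> J G R X Ka Kb xb (u True) (u False)"
proof -
  have ui: "integrable (lborel_on \<Omega>) (u j t)" if "t > 0" for j t
    using solves_from_zeroD(2)[OF \<Omega>_borel solves_mixtureD[OF u], of t j] that
    by (intro sq_integrable_integrable) simp
  have \<theta>i: "integrable (lborel_on \<Omega>) (phase_fraction X j)" for j
    using X by (cases j) (auto simp: phase_fraction_def[abs_def])
  show ?thesis
    unfolding limit_system_def
  proof
    show "solves_from_zero \<Omega> (u True) (limit_rhs_a \<Omega> J R X Ka xb (u True) (u False))"
    proof (rule solves_from_zero_cong[OF \<Omega>_borel solves_mixtureD[OF u]])
      fix t :: real and x assume "t > 0" "x \<in> \<Omega>"
      then show "exchange (phase_fraction X) (\<lambda>j. u j t) True x + exp (- t) * (S True x * phase_fraction X True x)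
          = limit_rhs_a \<Omega> J R X Ka xb (u True) (u False) t x"
        using exchange_eq_integral[of "\<lambda>j. u j t" "phase_fraction X" x True] ui \<theta>i
        by (simp add: UNIV_bool limit_rhs_a_def set_integral_eq[OF \<Omega>_borel] phase_fraction_def phase_kernels_def S)
    qed
    show "solves_from_zero \<Omega> (u False) (limit_rhs_b \<Omega> G R X Kb xb (u True) (u False))"
    proof (rule solves_from_zero_cong[OF \<Omega>_borel solves_mixtureD[OF u]])
      fix t :: real and x assume "t > 0" "x \<in> \<Omega>"
      then show "exchange (phase_fraction X) (\<lambda>j. u j t) False x + exp (- t) * (S False x * phase_fraction X False x)
          = limit_rhs_b \<Omega> G R X Kb xb (u True) (u False) t x"
        using exchange_eq_integral[of "\<lambda>j. u j t" "phase_fraction X" x False] ui \<theta>i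
        by (simp add: UNIV_bool limit_rhs_b_def set_integral_eq[OF \<Omega>_borel] phase_fraction_def phase_kernels_def S)
    qed
  qed
qed

text \<open>
  With \<open>\<theta>\<close> the indicator of one phase, \<open>\<theta> x * \<theta> x = \<theta> x\<close>; multiplying the equation for \<open>z\<close> by \<open>\<theta>\<close>
  therefore leaves exactly the equation of the mixture whose volume fractions are indicators.
\<close>

lemma jump_process_solves_mixture:
  assumes z: "solves_from_zero \<Omega> z (jump_rhs \<Omega> J G R A B xb z)"
    and cover: "\<Omega> \<subseteq> A \<union> B" and disjoint: "A \<inter> B = {}" and A: "A \<in> sets borel"
    and S: "S True = (\<lambda>x. indicator A xb * J xb x + indicator B xb * R xb x)"
      "S False = (\<lambda>x. indicator A xb * R xb x + indicator B xb * G xb x)"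
  shows "solves_mixture (phase_fraction (indicator A)) S (\<lambda>i t x. phase_fraction (indicator A) i x * z t x)"
  unfolding solves_mixture_def
proof
  fix i
  let ?\<theta> = "phase_fraction (indicator A) :: bool \<Rightarrow> 'a \<Rightarrow> real"
  have Am: "(indicator A :: 'a \<Rightarrow> real) \<in> borel_measurable (lborel_on \<Omega>)"
    using A by (intro measurable_restrict_space1) simp
  have \<theta>: "?\<theta> j \<in> borel_measurable (lborel_on \<Omega>)" for j
    using Am by (cases j) (auto simp: phase_fraction_def[abs_def])
  have \<theta>1: "\<bar>?\<theta> j x\<bar> \<le> 1" for j x by (auto simp: phase_fraction_def indicator_def)
  have \<theta>i: "integrable (lborel_on \<Omega>) (?\<theta> j)" for j
    using \<theta> \<theta>1 by (intro integrable_const_bound[where B = 1]) auto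
  have indB: "indicator B y = 1 - (indicator A y :: real)" if "y \<in> \<Omega>" for y
    using cover disjoint that by (auto simp: indicator_def)
  show "solves_from_zero \<Omega> (\<lambda>t x. ?\<theta> i x * z t x)
      (\<lambda>t x. exchange ?\<theta> (\<lambda>j x. ?\<theta> j x * z t x) i x + exp (- t) * (S i x * ?\<theta> i x))"
  proof (rule solves_from_zero_cong[OF \<Omega>_borel solves_from_zero_bounded_mult[OF \<Omega>_borel z \<theta> \<theta>1]])
    fix t :: real and x assume t: "t > 0" and x: "x \<in> \<Omega>"
    have zi: "integrable (lborel_on \<Omega>) (z t)"
      using solves_from_zeroD(2)[OF \<Omega>_borel z, of t] t by (intro sq_integrable_integrable) simp
    have "integrable (lborel_on \<Omega>) (\<lambda>x. ?\<theta> j x * z t x)" for j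
      by (rule bounded_mult_integrable[OF \<theta> \<theta>1 zi])
    then have ex: "exchange ?\<theta> (\<lambda>j x. ?\<theta> j x * z t x) i x = (\<Sum>j\<in>UNIV. \<integral>y. phase_kernels J G R i j x y *
        (?\<theta> i x * (?\<theta> j y * z t y) - ?\<theta> j y * (?\<theta> i x * z t x)) \<partial>lborel_on \<Omega>)"
      using \<theta>i x by (intro exchange_eq_integral) auto
    have LA: "(LINT y:\<Omega>|lborel. indicator A y * V x y * (z t y - z t x))
        = (\<integral>y. V x y * (indicator A y * z t y - indicator A y * z t x) \<partial>lborel_on \<Omega>)" for V :: "'a \<Rightarrow> 'a \<Rightarrow> real"
      unfolding set_integral_eq[OF \<Omega>_borel]
      by (intro Bochner_Integration.integral_cong refl) (simp add: algebra_simps)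
    have LB: "(LINT y:\<Omega>|lborel. indicator B y * V x y * (z t y - z t x))
        = (\<integral>y. V x y * ((1 - indicator A y) * z t y - (1 - indicator A y) * z t x) \<partial>lborel_on \<Omega>)" for V :: "'a \<Rightarrow> 'a \<Rightarrow> real"
      unfolding set_integral_eq[OF \<Omega>_borel]
      by (intro Bochner_Integration.integral_cong refl) (simp add: indB algebra_simps)
    show "?\<theta> i x * jump_rhs \<Omega> J G R A B xb z t x
        = exchange ?\<theta> (\<lambda>j x. ?\<theta> j x * z t x) i x + exp (- t) * (S i x * ?\<theta> i x)"
    proof (cases "x \<in> A")
      case True
      then have "x \<notin> B" using disjoint by auto
      with True show ?thesis
        unfolding ex jump_rhs_def LA LB
        by (cases i) (simp_all add: UNIV_bool phase_fraction_def phase_kernels_def S algebra_simps)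
    next
      case False
      then have "x \<in> B" using cover x by auto
      with False show ?thesis
        unfolding ex jump_rhs_def LA LB
        by (cases i) (simp_all add: UNIV_bool phase_fraction_def phase_kernels_def S algebra_simps)
    qed
  qed
qed

end

lemma jump_kernel_bounded:
  fixes \<Omega> :: "'a::euclidean_space set"
  assumes V: "jump_kernel V" and \<Omega>: "bounded \<Omega>"
  shows "\<exists>\<kappa>\<ge>0. \<forall>x\<in>\<Omega>. \<forall>y\<in>\<Omega>. \<bar>V x y\<bar> \<le> \<kappa>"
proof -
  have "continuous_on (closure \<Omega> \<times> closure \<Omega>) (\<lambda>(x, y). V x y)"
    using V by (auto simp: jump_kernel_def intro: continuous_on_subset)
  moreover have "compact (closure \<Omega> \<times> closure \<Omega>)"
    using \<Omega> by (intro compact_Times) (auto simp: compact_closure)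
  ultimately have "bounded ((\<lambda>(x, y). V x y) ` (closure \<Omega> \<times> closure \<Omega>))"
    by (intro compact_imp_bounded compact_continuous_image)
  then obtain c where c: "c > 0" "\<And>p. p \<in> closure \<Omega> \<times> closure \<Omega> \<Longrightarrow> \<bar>case p of (x, y) \<Rightarrow> V x y\<bar> \<le> c"
    unfolding bounded_pos by auto
  have "\<bar>V x y\<bar> \<le> c" if "x \<in> \<Omega>" "y \<in> \<Omega>" for x y
    using c(2)[of "(x, y)"] that closure_subset[of \<Omega>] by auto
  then show ?thesis using c(1) by (intro exI[of _ c]) auto
qed

lemma jump_kernel_measurable:
  fixes V :: "'a::euclidean_space \<Rightarrow> 'a \<Rightarrow> real"
  assumes "jump_kernel V"
  shows "case_prod V \<in> borel_measurable (lborel_on \<Omega> \<Otimes>\<^sub>M lborel_on \<Omega>)"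
proof -
  have "(\<lambda>(x, y). V x y) \<in> borel_measurable borel"
    using assms by (intro borel_measurable_continuous_onI) (simp add: jump_kernel_def)
  moreover have "(\<lambda>p :: 'a \<times> 'a. (fst p, snd p)) \<in> lborel_on \<Omega> \<Otimes>\<^sub>M lborel_on \<Omega> \<rightarrow>\<^sub>M borel \<Otimes>\<^sub>M borel"
    by (intro measurable_Pair measurable_compose[OF measurable_fst] measurable_compose[OF measurable_snd]
        measurable_restrict_space1) auto
  ultimately have "(\<lambda>p. case_prod V (fst p, snd p)) \<in> borel_measurable (lborel_on \<Omega> \<Otimes>\<^sub>M lborel_on \<Omega>)"
    unfolding borel_prod by (rule measurable_compose[rotated])
  then show ?thesis by (simp add: split_beta')
qed

lemma two_phase_kernels:
  fixes \<Omega> :: "'a::euclidean_space set"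
  assumes \<Omega>: "bounded \<Omega>" "\<Omega> \<in> sets borel"
    and J: "jump_kernel J" and G: "jump_kernel G" and R: "jump_kernel R"
  obtains \<kappa> where "two_phase \<Omega> J G R \<kappa>"
proof -
  obtain j g r where nonneg: "j \<ge> 0" "g \<ge> 0" "r \<ge> 0"
    and b: "\<And>x y. x \<in> \<Omega> \<Longrightarrow> y \<in> \<Omega> \<Longrightarrow> \<bar>J x y\<bar> \<le> j" "\<And>x y. x \<in> \<Omega> \<Longrightarrow> y \<in> \<Omega> \<Longrightarrow> \<bar>G x y\<bar> \<le> g"
      "\<And>x y. x \<in> \<Omega> \<Longrightarrow> y \<in> \<Omega> \<Longrightarrow> \<bar>R x y\<bar> \<le> r"
    using jump_kernel_bounded[OF J \<Omega>(1)] jump_kernel_bounded[OF G \<Omega>(1)] jump_kernel_bounded[OF R \<Omega>(1)]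
    by metis
  interpret finite_measure "lborel_on \<Omega>" by (rule finite_measure_lborel_on[OF \<Omega>])
  have "two_phase \<Omega> J G R (j + g + r)"
  proof
    fix i k
    show "case_prod (phase_kernels J G R i k) \<in> borel_measurable (lborel_on \<Omega> \<Otimes>\<^sub>M lborel_on \<Omega>)"
      by (simp add: phase_kernels_def jump_kernel_measurable J G R)
    fix x y assume "x \<in> space (lborel_on \<Omega>)" "y \<in> space (lborel_on \<Omega>)"
    then have xy: "x \<in> \<Omega>" "y \<in> \<Omega>" using \<Omega>(2) by auto
    show "\<bar>phase_kernels J G R i k x y\<bar> \<le> j + g + r"
      using b(1)[OF xy] b(2)[OF xy] b(3)[OF xy] nonneg by (simp add: phase_kernels_def)
  qed (use nonneg \<Omega> in auto)
  then show ?thesis by (rule that)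
qed

lemma weakly_Linf_imp_weak_star:
  assumes weak: "weakly_Linf C f g" and C: "C \<in> sets borel" and S: "S \<in> sets borel" "S \<subseteq> C"
  shows "weak_star (lborel_on S) f g"
  unfolding weak_star_def
proof (intro allI impI)
  fix \<phi> :: "'a \<Rightarrow> real" assume "integrable (lborel_on S) \<phi>"
  then have "integrable lborel (\<lambda>x. indicator S x * \<phi> x)"
    using S(1) by (simp add: integrable_restrict_space)
  moreover have "indicator C x * (indicator S x * \<phi> x) = indicator S x * \<phi> x" for x
    using S(2) by (auto simp: indicator_def)
  ultimately have "set_integrable lborel C (\<lambda>x. indicator S x * \<phi> x)"
    unfolding set_integrable_def real_scaleR_def by (simp only:)
  then have "(\<lambda>n. LINT x:C|lborel. f n x * (indicator S x * \<phi> x))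
      \<longlonglongrightarrow> (LINT x:C|lborel. g x * (indicator S x * \<phi> x))"
    using weak by (simp add: weakly_Linf_def)
  moreover have "(LINT x:C|lborel. h x * (indicator S x * \<phi> x)) = (\<integral>x. h x * \<phi> x \<partial>lborel_on S)" for h
  proof -
    have "(LINT x:C|lborel. h x * (indicator S x * \<phi> x)) = (LINT x:S|lborel. h x * \<phi> x)"
      unfolding set_lebesgue_integral_def
      by (intro Bochner_Integration.integral_cong refl) (use S(2) in \<open>auto simp: indicator_def\<close>)
    then show ?thesis by (simp add: set_integral_eq[OF S(1)])
  qed
  ultimately show "(\<lambda>n. \<integral>x. f n x * \<phi> x \<partial>lborel_on S) \<longlonglongrightarrow> (\<integral>x. g x * \<phi> x \<partial>lborel_on S)"
    by simp
qed

lemma weak_star_cong_AE: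
  assumes "weak_star \<nu> f g" and "g \<in> borel_measurable \<nu>" and "g' \<in> borel_measurable \<nu>"
    and "AE x in \<nu>. g x = g' x"
  shows "weak_star \<nu> f g'"
  unfolding weak_star_def
proof (intro allI impI)
  fix \<phi> :: "'a \<Rightarrow> real" assume \<phi>: "integrable \<nu> \<phi>"
  then have [measurable]: "\<phi> \<in> borel_measurable \<nu>" by auto
  note [measurable] = assms(2,3)
  have "(\<integral>x. g x * \<phi> x \<partial>\<nu>) = (\<integral>x. g' x * \<phi> x \<partial>\<nu>)"
    by (rule integral_cong_AE) (use assms(4) in auto)
  with weak_starD[OF assms(1) \<phi>] show "(\<lambda>n. \<integral>x. f n x * \<phi> x \<partial>\<nu>) \<longlonglongrightarrow> (\<integral>x. g' x * \<phi> x \<partial>\<nu>)"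
    by simp
qed

section \<open>Homogenization of the jump process\<close>

theorem theorem1p4:
  fixes \<Omega> :: "'a::euclidean_space set"
    and J G R :: "'a \<Rightarrow> 'a \<Rightarrow> real"
    and A B :: "nat \<Rightarrow> 'a set"
    and X :: "'a \<Rightarrow> real"
    and xb :: 'a
    and z :: "nat \<Rightarrow> real \<Rightarrow> 'a \<Rightarrow> real"
    and T :: real
  assumes "open \<Omega>" and "connected \<Omega>" and "bounded \<Omega>"
    and "jump_kernel J" and "jump_kernel G" and "jump_kernel R"
    and "\<And>n. closure \<Omega> = A n \<union> B n"
    and "\<And>n. A n \<inter> B n = {}"
    and "\<And>n. open (B n)"
    and "\<And>n. lipschitz_boundary (B n)"
    and "weakly_Linf (closure \<Omega>) (\<lambda>n. indicator (A n)) X"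
    and "weakly_Linf (closure \<Omega>) (\<lambda>n. indicator (B n)) (\<lambda>x. 1 - X x)"
    and "AE x in lborel. x \<in> closure \<Omega> \<longrightarrow> 0 < X x \<and> X x < 1"
    and "xb \<in> \<Omega>"
    and "\<And>n. indicator (A n) xb * (LINT y:\<Omega>|lborel. indicator (A n) y * J xb y)
            + indicator (B n) xb * (LINT y:\<Omega>|lborel. indicator (B n) y * G xb y)
            + indicator (A n) xb * (LINT y:\<Omega>|lborel. indicator (B n) y * R xb y)
            + indicator (B n) xb * (LINT y:\<Omega>|lborel. indicator (A n) y * R xb y) = 1"
    and "\<And>n. solves_from_zero \<Omega> (z n) (jump_rhs \<Omega> J G R (A n) (B n) xb (z n))"
    and "T > 0"
  shows "\<exists>r w a b. strict_mono (r :: nat \<Rightarrow> nat) \<and>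
           weakly_L2 ({0<..<T} \<times> \<Omega>) (\<lambda>k (t, x). z (r k) t x) w \<and>
           weakly_L2 ({0<..<T} \<times> \<Omega>)
             (\<lambda>k (t, x). indicator (A (r k)) x * z (r k) t x) (\<lambda>(t, x). a t x) \<and>
           weakly_L2 ({0<..<T} \<times> \<Omega>)
             (\<lambda>k (t, x). indicator (B (r k)) x * z (r k) t x) (\<lambda>(t, x). b t x) \<and>
           (limit_system \<Omega> J G R X J R xb a b \<or> limit_system \<Omega> J G R X R G xb a b)"
proof -
  have \<Omega>b: "\<Omega> \<in> sets borel" and Cb: "closure \<Omega> \<in> sets borel"
    using \<open>open \<Omega>\<close> by auto
  obtain \<kappa> where "two_phase \<Omega> J G R \<kappa>"
    using two_phase_kernels[OF \<open>bounded \<Omega>\<close> \<Omega>b \<open>jump_kernel J\<close> \<open>jump_kernel G\<close> \<open>jump_kernel R\<close>] .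
  then interpret two_phase \<Omega> J G R \<kappa> .
  let ?\<mu> = "lborel_on \<Omega>"
  have Ab: "A n \<in> sets borel" for n
  proof -
    have "A n = closure \<Omega> - B n" using assms(7,8)[of n] by auto
    then show ?thesis using assms(9)[of n] Cb by auto
  qed
  have cover: "\<Omega> \<subseteq> A n \<union> B n" for n
    using assms(7)[of n] closure_subset by auto
  \<comment> \<open>A representative of \<open>X\<close> that lies in \<open>[0, 1]\<close> at every point, as the series requires.\<close>
  define Y where "Y = (\<lambda>x. max 0 (min 1 (X x)))"
  have Xm [measurable]: "X \<in> borel_measurable ?\<mu>"
  proof -
    have "(\<lambda>x. indicator (closure \<Omega>) x * X x) \<in> borel_measurable ?\<mu>"
      using assms(11) by (intro measurable_restrict_space1)
        (simp add: weakly_Linf_def Linf_def set_borel_measurable_def)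
    then show ?thesis
      by (rule measurable_cong[THEN iffD1, rotated]) (use closure_subset[of \<Omega>] in auto)
  qed
  have Ym [measurable]: "Y \<in> borel_measurable ?\<mu>" unfolding Y_def by measurable
  have X01: "AE x in ?\<mu>. 0 < X x \<and> X x < 1"
    unfolding AE_lborel_on_iff[OF \<Omega>b] using assms(13) closure_subset[of \<Omega>] by (auto elim: eventually_mono)
  then have XY: "AE x in ?\<mu>. Y x = X x"
    by eventually_elim (simp add: Y_def)
  have Xi: "integrable ?\<mu> X"
    by (rule integrable_const_bound[where B = 1]) (use X01 in \<open>auto elim: eventually_mono\<close>)
  have phase_fraction1: "bounded_family 1 (phase_fraction U)"
    if "U \<in> borel_measurable ?\<mu>" "\<And>x. 0 \<le> U x" "\<And>x. U x \<le> 1" for U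
    unfolding bounded_family_def
  proof (intro allI conjI ballI)
    fix i
    show "phase_fraction U i \<in> borel_measurable ?\<mu>" using that(1) by (cases i) (auto simp: phase_fraction_def[abs_def])
    show "\<bar>phase_fraction U i x\<bar> \<le> 1" for x using that(2,3)[of x] by (auto simp: phase_fraction_def)
  qed
  have \<theta>A: "bounded_family 1 (phase_fraction (indicator (A n)))" for n
    using Ab[of n] by (intro phase_fraction1 measurable_restrict_space1) (auto simp: indicator_def)
  have \<theta>Y: "bounded_family 1 (phase_fraction Y)"
    by (rule phase_fraction1[OF Ym]) (auto simp: Y_def)
  have weakA: "weak_star ?\<mu> (\<lambda>n. indicator (A n)) Y"
    by (rule weak_star_cong_AE[OF weakly_Linf_imp_weak_star[OF assms(11) Cb \<Omega>b closure_subset] Xm Ym])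
       (use XY in \<open>auto elim: eventually_mono\<close>)
  \<comment> \<open>The convergence along any subsequence on which the source does not change.\<close>
  have main: "\<exists>w a b. weakly_L2 ({0<..<T} \<times> \<Omega>) (\<lambda>k (t, x). z (r k) t x) w \<and>
           weakly_L2 ({0<..<T} \<times> \<Omega>)
             (\<lambda>k (t, x). indicator (A (r k)) x * z (r k) t x) (\<lambda>(t, x). a t x) \<and>
           weakly_L2 ({0<..<T} \<times> \<Omega>)
             (\<lambda>k (t, x). indicator (B (r k)) x * z (r k) t x) (\<lambda>(t, x). b t x) \<and>
           limit_system \<Omega> J G R X Ka Kb xb a b"
    if r: "strict_mono r"
      and Ka: "\<And>k. Ka xb = (\<lambda>x. indicator (A (r k)) xb * J xb x + indicator (B (r k)) xb * R xb x)"
      and Kb: "\<And>k. Kb xb = (\<lambda>x. indicator (A (r k)) xb * R xb x + indicator (B (r k)) xb * G xb x)"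
      and KaKb: "Ka = J \<or> Ka = R" "Kb = R \<or> Kb = G"
    for r :: "nat \<Rightarrow> nat" and Ka Kb :: "'a \<Rightarrow> 'a \<Rightarrow> real"
  proof -
    define S where "S = (\<lambda>i. if i then Ka xb else Kb xb)"
    let ?\<theta> = "\<lambda>k. phase_fraction (indicator (A (r k))) :: bool \<Rightarrow> 'a \<Rightarrow> real"
    let ?v = "\<lambda>k i t x. ?\<theta> k i x * z (r k) t x"
    have S: "bounded_family \<kappa> S"
    proof -
      have "\<exists>j k. S i = phase_kernels J G R j k xb" for i
        using KaKb by (cases i) (auto simp: S_def phase_kernels_def)
      then show ?thesis
        unfolding bounded_family_def using K_section_measurable K_bound \<open>xb \<in> \<Omega>\<close>
        by (metis space_lborel_on)
    qed
    have sol: "solves_mixture (?\<theta> k) S (?v k)" for k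
      by (rule jump_process_solves_mixture[OF assms(16) cover assms(8) Ab])
         (simp_all add: S_def Ka[of k] Kb[of k])
    have weak1: "weak_star ?\<mu> (\<lambda>k. indicator (A (r k))) Y"
      using weakA LIMSEQ_subseq_LIMSEQ[OF _ r] by (auto simp: weak_star_def o_def)
    have "weak_star ?\<mu> (\<lambda>k x. 1 + (- 1) * indicator (A (r k)) x) (\<lambda>x. 1 + (- 1) * Y x)"
    proof (rule weak_star_add[OF _ weak1, where c = 1])
      show "weak_star ?\<mu> (\<lambda>n x. 1) (\<lambda>x. 1)" by (simp add: weak_star_def)
      show "indicator (A (r n)) \<in> borel_measurable ?\<mu>" for n
        using Ab by (intro measurable_restrict_space1) simp
    qed (auto simp: Y_def indicator_def)
    then have weak: "weak_star ?\<mu> (\<lambda>k. ?\<theta> k i) (phase_fraction Y i)" for i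
      using weak1 by (cases i) (simp_all add: phase_fraction_def[abs_def])
    let ?u = "flow (phase_fraction Y) S"
    have conv: "weakly_L2 ({0<..<T} \<times> \<Omega>) (\<lambda>k (t, x). ?v k i t x) (\<lambda>(t, x). ?u i t x)" for i
      by (rule flow_weakly_L2[OF \<theta>A \<theta>Y S \<kappa>_nonneg weak sol \<open>bounded \<Omega>\<close>])
    have a: "weakly_L2 ({0<..<T} \<times> \<Omega>) (\<lambda>k (t, x). indicator (A (r k)) x * z (r k) t x) (\<lambda>(t, x). ?u True t x)"
      using conv[of True] by (simp add: phase_fraction_def)
    have b: "weakly_L2 ({0<..<T} \<times> \<Omega>) (\<lambda>k (t, x). indicator (B (r k)) x * z (r k) t x) (\<lambda>(t, x). ?u False t x)"
    proof (rule weakly_L2_cong[OF conv[of False]])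
      fix k and p :: "real \<times> 'a" assume "p \<in> {0<..<T} \<times> \<Omega>"
      then have "1 - indicator (A (r k)) (snd p) = (indicator (B (r k)) (snd p) :: real)"
        using cover[of "r k"] assms(8)[of "r k"] by (auto simp: indicator_def)
      then show "(case p of (t, x) \<Rightarrow> ?v k False t x) = (case p of (t, x) \<Rightarrow> indicator (B (r k)) x * z (r k) t x)"
        by (simp add: phase_fraction_def split_beta')
    qed
    have "weakly_L2 ({0<..<T} \<times> \<Omega>) (\<lambda>k (t, x). z (r k) t x)
        (\<lambda>p. (case p of (t, x) \<Rightarrow> ?u True t x) + (case p of (t, x) \<Rightarrow> ?u False t x))"
      by (rule weakly_L2_cong[OF weakly_L2_add[OF _ conv[of True] conv[of False]]])
         (auto simp: phase_fraction_def algebra_simps intro: borel_Times \<Omega>b)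
    moreover have "limit_system \<Omega> J G R X Ka Kb xb (?u True) (?u False)"
    proof (rule limit_systemI[OF _ Xi])
      show "solves_mixture (phase_fraction X) S ?u"
      proof (rule solves_mixture_cong_AE[OF flow_solves[OF \<theta>Y S \<kappa>_nonneg]])
        fix i
        show "phase_fraction Y i \<in> borel_measurable ?\<mu>" by (rule bounded_familyD(1)[OF \<theta>Y])
        show "phase_fraction X i \<in> borel_measurable ?\<mu>" using Xm by (cases i) (auto simp: phase_fraction_def[abs_def])
        show "S i \<in> borel_measurable ?\<mu>" by (rule bounded_familyD(1)[OF S])
        show "AE x in ?\<mu>. phase_fraction Y i x = phase_fraction X i x"
          using XY by eventually_elim (simp add: phase_fraction_def)
      qed
    qed (simp_all add: S_def)
    ultimately show ?thesis using a b by blast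
  qed
  have "xb \<in> A n \<or> xb \<in> B n" for n using cover \<open>xb \<in> \<Omega>\<close> by blast
  then have "{n. xb \<in> A n} \<union> {n. xb \<in> B n} = UNIV" by auto
  then have "infinite {n. xb \<in> A n} \<or> infinite {n. xb \<in> B n}"
    by (metis finite_Un infinite_UNIV_nat)
  then show ?thesis
  proof
    assume inf: "infinite {n. xb \<in> A n}"
    define r where "r = enumerate {n. xb \<in> A n}"
    have r: "strict_mono r" unfolding r_def by (rule strict_mono_enumerate[OF inf])
    have "xb \<in> A (r k)" for k using enumerate_in_set[OF inf, of k] by (simp add: r_def)
    moreover from this have "xb \<notin> B (r k)" for k using assms(8)[of "r k"] by auto
    ultimately show ?thesis using main[OF r, of J R] r by auto
  next
    assume inf: "infinite {n. xb \<in> B n}"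
    define r where "r = enumerate {n. xb \<in> B n}"
    have r: "strict_mono r" unfolding r_def by (rule strict_mono_enumerate[OF inf])
    have "xb \<in> B (r k)" for k using enumerate_in_set[OF inf, of k] by (simp add: r_def)
    moreover from this have "xb \<notin> A (r k)" for k using assms(8)[of "r k"] by auto
    ultimately show ?thesis using main[OF r, of R G] r by auto
  qed
qed

end
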